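(* The system $\mathsf{P}_0+(\mathsf{E})^{\mathrm{st}}_2+\mathsf{STP}_2$ proves $(\exists^2)^{\mathrm{st}}$.
   Context: Types: $0$, $1=0\to0$, $2=1\to0$. $\mathsf{E\text{-}PRA}^{\omega*}$ is Kohlenbach's primitive recursive arithmetic in all finite types with extensionality, extended with finite-sequence types. With a predicate $\mathrm{st}$ (internal = st-free; $A^{\mathrm{st}}$ = $A$ with all quantifiers relativised to st), $\mathsf{P}_0$ is $\mathsf{E\text{-}PRA}^{\omega*}+\mathsf{QF\text{-}AC}^{1,0}$ plus $\mathrm{st}(x)\wedge x=y\to\mathrm{st}(y)$, $\mathrm{st}(t)$ for closed terms $t$, $\mathrm{st}(f)\wedge\mathrm{st}(x)\to\mathrm{st}(f(x))$, $\mathsf{HAC}_{\mathrm{int}}$ (internal $\varphi$: $(\forall^{\mathrm{st}}x)(\exists^{\mathrm{st}}y)\varphi\to(\exists^{\mathrm{st}}F)(\forall^{\mathrm{st}}x)(\exists y\in F(x))\varphi(x,y)$, $F(x)$ a finite sequence), and idealisation $\mathsf{I}$ (internal $\varphi$: $(\forall^{\mathrm{st}}x^{\sigma^*})(\exists y)(\forall z\in x)\varphi(z,y)\to(\exists y)(\forall^{\mathrm{st}}x^\sigma)\varphi(x,y)$); $\mathsf{QF\text{-}AC}^{1,0}$ is $(\forall x^1)(\exists y^0)\varphi\to(\exists F)(\forall x^1)\varphi(x,F(x))$ for quantifier-free $\varphi$. $(\mathsf{E})_2$ is extensionality for type-2 functionals: $(\forall x^1,y^1,\varphi^2)(x=_1y\to\varphi(x)=_0\varphi(y))$,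 where $x=_1y$ means $(\forall n)x(n)=y(n)$; $(\mathsf{E})^{\mathrm{st}}_2$ is its relativisation to st. $Y^2\le_21$ means $Y(f)\le1$ for all $f^1$; $Z\approx_2Y$ means $(\forall^{\mathrm{st}}f^1)Z(f)=Y(f)$. $\mathsf{STP}_2$: $(\forall Y^2\le_21)(\exists^{\mathrm{st}}Z^2\le_21)(Z\approx_2Y)$. $(\exists^2)$: $(\exists\varphi^2)(\forall f^1)((\exists n)f(n)=0\leftrightarrow\varphi(f)=0)$; $(\exists^2)^{\mathrm{st}}$ is its relativisation to st. *)

theory Defs
  imports Main
begin

section \<open>Finite types, terms and formulas\<close>

datatype ty = N | Fun ty ty (infixr "\<rightarrow>" 80) | Seq ty

abbreviation ty1 :: ty where "ty1 \<equiv> N \<rightarrow> N"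
abbreviation ty2 :: ty where "ty2 \<equiv> ty1 \<rightarrow> N"

text \<open>
  The constants: zero and successor, the combinators \<open>\<Pi>\<close> and \<open>\<Sigma>\<close> in all types, Kohlenbach's
  predicative recursor \<open>R\<^sub>0\<close> (recursion on type 0 with result of type 0 only), and, for the types
  of finite sequences, the empty sequence, prefixing of an element, the list recursor, length,
  the entry at a position, and the initial segment \<open>\<langle>f 0, \<dots>, f (n - 1)\<rangle>\<close> of \<open>f\<close> (\<open>TabC\<close>).
  The list recursor is restricted to results of type 0, as \<open>R\<^sub>0\<close> is: at higher result types it would
  define all of Goedel's primitive recursive functionals. Entries, initial segments and (via
  \<open>TabC\<close>) concatenation are not definable from the restricted recursor at all types, so entries
  and initial segments are primitive. No strength is added by this: a finite sequence can be
  read as a length together with a function from type 0.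
\<close>

datatype cn =
    Zero
  | Succ
  | PiC ty ty
  | SigmaC ty ty ty
  | RecC
  | NilC ty
  | ConsC ty
  | LRecC ty
  | LenC ty
  | AtC ty
  | TabC ty

primrec cn_ty :: "cn \<Rightarrow> ty" where
  "cn_ty Zero = N"
| "cn_ty Succ = N \<rightarrow> N"
| "cn_ty (PiC \<rho> \<tau>) = \<rho> \<rightarrow> \<tau> \<rightarrow> \<rho>"
| "cn_ty (SigmaC \<delta> \<rho> \<tau>) = (\<delta> \<rightarrow> \<rho> \<rightarrow> \<tau>) \<rightarrow> (\<delta> \<rightarrow> \<rho>) \<rightarrow> \<delta> \<rightarrow> \<tau>"
| "cn_ty RecC = N \<rightarrow> N \<rightarrow> (N \<rightarrow> N \<rightarrow> N) \<rightarrow> N"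
| "cn_ty (NilC \<sigma>) = Seq \<sigma>"
| "cn_ty (ConsC \<sigma>) = \<sigma> \<rightarrow> Seq \<sigma> \<rightarrow> Seq \<sigma>"
| "cn_ty (LRecC \<sigma>) = Seq \<sigma> \<rightarrow> N \<rightarrow> (N \<rightarrow> \<sigma> \<rightarrow> N) \<rightarrow> N"
| "cn_ty (LenC \<sigma>) = Seq \<sigma> \<rightarrow> N"
| "cn_ty (AtC \<sigma>) = Seq \<sigma> \<rightarrow> N \<rightarrow> \<sigma>"
| "cn_ty (TabC \<sigma>) = (N \<rightarrow> \<sigma>) \<rightarrow> N \<rightarrow> Seq \<sigma>"

text \<open>
  Syntax is locally nameless: a variable is a name together with its type, and an occurrence
  bound by a quantifier is a de Bruijn index, so that formulas are identified up to renaming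
  of bound variables. The constructors \<open>All\<close> and \<open>Ex\<close> record the type of the bound variable.
\<close>

type_synonym var = "nat \<times> ty"

datatype tm = Fv var | Bv nat | Cn cn | App tm tm (infixl "\<cdot>" 75)

datatype fm =
    Fls
  | Eq tm tm (infix "\<^bold>=" 60)
  | St tm
  | Conj fm fm (infixr "\<^bold>\<and>" 57)
  | Disj fm fm (infixr "\<^bold>\<or>" 56)
  | Imp fm fm (infixr "\<^bold>\<longrightarrow>" 55)
  | All ty fm
  | Ex ty fm

abbreviation Neg :: "fm \<Rightarrow> fm" ("\<^bold>\<not> _" [58] 58) where
  "\<^bold>\<not> \<phi> \<equiv> \<phi> \<^bold>\<longrightarrow> Fls"

abbreviation Iff :: "fm \<Rightarrow> fm \<Rightarrow> fm" (infix "\<^bold>\<longleftrightarrow>" 55) where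
  "\<phi> \<^bold>\<longleftrightarrow> \<psi> \<equiv> (\<phi> \<^bold>\<longrightarrow> \<psi>) \<^bold>\<and> (\<psi> \<^bold>\<longrightarrow> \<phi>)"

text \<open>The list \<open>\<Delta>\<close> gives the types of the de Bruijn indices. The prime formulas are equations
  between terms of type 0 and \<open>st(t)\<close> for \<open>t\<close> of any type.\<close>

inductive has_ty :: "ty list \<Rightarrow> tm \<Rightarrow> ty \<Rightarrow> bool" ("_ \<turnstile> _ \<triangleright> _" [61, 61, 61] 60) where
  ty_Fv: "\<Delta> \<turnstile> Fv (n, \<sigma>) \<triangleright> \<sigma>"
| ty_Bv: "i < length \<Delta> \<Longrightarrow> \<Delta> \<turnstile> Bv i \<triangleright> (\<Delta> ! i)"
| ty_Cn: "\<Delta> \<turnstile> Cn c \<triangleright> cn_ty c"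
| ty_App: "\<Delta> \<turnstile> s \<triangleright> (\<sigma> \<rightarrow> \<tau>) \<Longrightarrow> \<Delta> \<turnstile> t \<triangleright> \<sigma> \<Longrightarrow> \<Delta> \<turnstile> s \<cdot> t \<triangleright> \<tau>"

primrec wf_fm :: "ty list \<Rightarrow> fm \<Rightarrow> bool" where
  "wf_fm \<Delta> Fls \<longleftrightarrow> True"
| "wf_fm \<Delta> (s \<^bold>= t) \<longleftrightarrow> \<Delta> \<turnstile> s \<triangleright> N \<and> \<Delta> \<turnstile> t \<triangleright> N"
| "wf_fm \<Delta> (St t) \<longleftrightarrow> (\<exists>\<sigma>. \<Delta> \<turnstile> t \<triangleright> \<sigma>)"
| "wf_fm \<Delta> (\<phi> \<^bold>\<and> \<psi>) \<longleftrightarrow> wf_fm \<Delta> \<phi> \<and> wf_fm \<Delta> \<psi>"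
| "wf_fm \<Delta> (\<phi> \<^bold>\<or> \<psi>) \<longleftrightarrow> wf_fm \<Delta> \<phi> \<and> wf_fm \<Delta> \<psi>"
| "wf_fm \<Delta> (\<phi> \<^bold>\<longrightarrow> \<psi>) \<longleftrightarrow> wf_fm \<Delta> \<phi> \<and> wf_fm \<Delta> \<psi>"
| "wf_fm \<Delta> (All \<sigma> \<phi>) \<longleftrightarrow> wf_fm (\<sigma> # \<Delta>) \<phi>"
| "wf_fm \<Delta> (Ex \<sigma> \<phi>) \<longleftrightarrow> wf_fm (\<sigma> # \<Delta>) \<phi>"

abbreviation term_of_ty :: "tm \<Rightarrow> ty \<Rightarrow> bool" where "term_of_ty t \<sigma> \<equiv> [] \<turnstile> t \<triangleright> \<sigma>"
abbreviation formula :: "fm \<Rightarrow> bool" where "formula \<phi> \<equiv> wf_fm [] \<phi>"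

primrec fv_tm :: "tm \<Rightarrow> var set" where
  "fv_tm (Fv x) = {x}"
| "fv_tm (Bv i) = {}"
| "fv_tm (Cn c) = {}"
| "fv_tm (s \<cdot> t) = fv_tm s \<union> fv_tm t"

primrec fv :: "fm \<Rightarrow> var set" where
  "fv Fls = {}"
| "fv (s \<^bold>= t) = fv_tm s \<union> fv_tm t"
| "fv (St t) = fv_tm t"
| "fv (\<phi> \<^bold>\<and> \<psi>) = fv \<phi> \<union> fv \<psi>"
| "fv (\<phi> \<^bold>\<or> \<psi>) = fv \<phi> \<union> fv \<psi>"
| "fv (\<phi> \<^bold>\<longrightarrow> \<psi>) = fv \<phi> \<union> fv \<psi>"
| "fv (All \<sigma> \<phi>) = fv \<phi>"
| "fv (Ex \<sigma> \<phi>) = fv \<phi>"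

text \<open>\<open>opn k u\<close> replaces the index \<open>k\<close> by the term \<open>u\<close> (which has no indices itself), and
  \<open>cls k x\<close> replaces the free variable \<open>x\<close> by the index \<open>k\<close>.\<close>

primrec opn_tm :: "nat \<Rightarrow> tm \<Rightarrow> tm \<Rightarrow> tm" where
  "opn_tm k u (Fv x) = Fv x"
| "opn_tm k u (Bv i) = (if i = k then u else Bv i)"
| "opn_tm k u (Cn c) = Cn c"
| "opn_tm k u (s \<cdot> t) = opn_tm k u s \<cdot> opn_tm k u t"

primrec opn :: "nat \<Rightarrow> tm \<Rightarrow> fm \<Rightarrow> fm" where
  "opn k u Fls = Fls"
| "opn k u (s \<^bold>= t) = (opn_tm k u s \<^bold>= opn_tm k u t)"
| "opn k u (St t) = St (opn_tm k u t)"
| "opn k u (\<phi> \<^bold>\<and> \<psi>) = (opn k u \<phi> \<^bold>\<and> opn k u \<psi>)"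
| "opn k u (\<phi> \<^bold>\<or> \<psi>) = (opn k u \<phi> \<^bold>\<or> opn k u \<psi>)"
| "opn k u (\<phi> \<^bold>\<longrightarrow> \<psi>) = (opn k u \<phi> \<^bold>\<longrightarrow> opn k u \<psi>)"
| "opn k u (All \<sigma> \<phi>) = All \<sigma> (opn (Suc k) u \<phi>)"
| "opn k u (Ex \<sigma> \<phi>) = Ex \<sigma> (opn (Suc k) u \<phi>)"

primrec cls_tm :: "nat \<Rightarrow> var \<Rightarrow> tm \<Rightarrow> tm" where
  "cls_tm k x (Fv y) = (if y = x then Bv k else Fv y)"
| "cls_tm k x (Bv i) = Bv i"
| "cls_tm k x (Cn c) = Cn c"
| "cls_tm k x (s \<cdot> t) = cls_tm k x s \<cdot> cls_tm k x t"

primrec cls :: "nat \<Rightarrow> var \<Rightarrow> fm \<Rightarrow> fm" where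
  "cls k x Fls = Fls"
| "cls k x (s \<^bold>= t) = (cls_tm k x s \<^bold>= cls_tm k x t)"
| "cls k x (St t) = St (cls_tm k x t)"
| "cls k x (\<phi> \<^bold>\<and> \<psi>) = (cls k x \<phi> \<^bold>\<and> cls k x \<psi>)"
| "cls k x (\<phi> \<^bold>\<or> \<psi>) = (cls k x \<phi> \<^bold>\<or> cls k x \<psi>)"
| "cls k x (\<phi> \<^bold>\<longrightarrow> \<psi>) = (cls k x \<phi> \<^bold>\<longrightarrow> cls k x \<psi>)"
| "cls k x (All \<sigma> \<phi>) = All \<sigma> (cls (Suc k) x \<phi>)"
| "cls k x (Ex \<sigma> \<phi>) = Ex \<sigma> (cls (Suc k) x \<phi>)"

definition subst :: "var \<Rightarrow> tm \<Rightarrow> fm \<Rightarrow> fm" where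
  "subst x t \<phi> = opn 0 t (cls 0 x \<phi>)"

definition all_v :: "var \<Rightarrow> fm \<Rightarrow> fm" ("\<^bold>\<forall>_. _" [100, 54] 54) where
  "\<^bold>\<forall>x. \<phi> = All (snd x) (cls 0 x \<phi>)"

definition ex_v :: "var \<Rightarrow> fm \<Rightarrow> fm" ("\<^bold>\<exists>_. _" [100, 54] 54) where
  "\<^bold>\<exists>x. \<phi> = Ex (snd x) (cls 0 x \<phi>)"

abbreviation all_st :: "var \<Rightarrow> fm \<Rightarrow> fm" ("\<^bold>\<forall>\<^sup>s\<^sup>t_. _" [100, 54] 54) where
  "\<^bold>\<forall>\<^sup>s\<^sup>tx. \<phi> \<equiv> \<^bold>\<forall>x. (St (Fv x) \<^bold>\<longrightarrow> \<phi>)"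

abbreviation ex_st :: "var \<Rightarrow> fm \<Rightarrow> fm" ("\<^bold>\<exists>\<^sup>s\<^sup>t_. _" [100, 54] 54) where
  "\<^bold>\<exists>\<^sup>s\<^sup>tx. \<phi> \<equiv> \<^bold>\<exists>x. (St (Fv x) \<^bold>\<and> \<phi>)"

text \<open>The relativisation \<open>A\<^sup>s\<^sup>t\<close>.\<close>

primrec relat :: "fm \<Rightarrow> fm" where
  "relat Fls = Fls"
| "relat (s \<^bold>= t) = (s \<^bold>= t)"
| "relat (St t) = St t"
| "relat (\<phi> \<^bold>\<and> \<psi>) = (relat \<phi> \<^bold>\<and> relat \<psi>)"
| "relat (\<phi> \<^bold>\<or> \<psi>) = (relat \<phi> \<^bold>\<or> relat \<psi>)"
| "relat (\<phi> \<^bold>\<longrightarrow> \<psi>) = (relat \<phi> \<^bold>\<longrightarrow> relat \<psi>)"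
| "relat (All \<sigma> \<phi>) = All \<sigma> (St (Bv 0) \<^bold>\<longrightarrow> relat \<phi>)"
| "relat (Ex \<sigma> \<phi>) = Ex \<sigma> (St (Bv 0) \<^bold>\<and> relat \<phi>)"

primrec internal :: "fm \<Rightarrow> bool" where
  "internal Fls \<longleftrightarrow> True"
| "internal (s \<^bold>= t) \<longleftrightarrow> True"
| "internal (St t) \<longleftrightarrow> False"
| "internal (\<phi> \<^bold>\<and> \<psi>) \<longleftrightarrow> internal \<phi> \<and> internal \<psi>"
| "internal (\<phi> \<^bold>\<or> \<psi>) \<longleftrightarrow> internal \<phi> \<and> internal \<psi>"
| "internal (\<phi> \<^bold>\<longrightarrow> \<psi>) \<longleftrightarrow> internal \<phi> \<and> internal \<psi>"
| "internal (All \<sigma> \<phi>) \<longleftrightarrow> internal \<phi>"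
| "internal (Ex \<sigma> \<phi>) \<longleftrightarrow> internal \<phi>"

text \<open>Quantifier-free formulas of the language without \<open>st\<close>.\<close>

primrec qf :: "fm \<Rightarrow> bool" where
  "qf Fls \<longleftrightarrow> True"
| "qf (s \<^bold>= t) \<longleftrightarrow> True"
| "qf (St t) \<longleftrightarrow> False"
| "qf (\<phi> \<^bold>\<and> \<psi>) \<longleftrightarrow> qf \<phi> \<and> qf \<psi>"
| "qf (\<phi> \<^bold>\<or> \<psi>) \<longleftrightarrow> qf \<phi> \<and> qf \<psi>"
| "qf (\<phi> \<^bold>\<longrightarrow> \<psi>) \<longleftrightarrow> qf \<phi> \<and> qf \<psi>"
| "qf (All \<sigma> \<phi>) \<longleftrightarrow> False"
| "qf (Ex \<sigma> \<phi>) \<longleftrightarrow> False"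


section \<open>Defined notions\<close>

abbreviation zero :: tm where "zero \<equiv> Cn Zero"
abbreviation succ :: "tm \<Rightarrow> tm" where "succ t \<equiv> Cn Succ \<cdot> t"
abbreviation rec0 :: "tm \<Rightarrow> tm \<Rightarrow> tm \<Rightarrow> tm" where "rec0 n y z \<equiv> Cn RecC \<cdot> n \<cdot> y \<cdot> z"

text \<open>\<open>pred_fun\<close> is \<open>\<lambda>r. R\<^sub>0 r 0 (\<lambda>q i. i)\<close>; truncated subtraction \<open>s - t\<close> is
  \<open>R\<^sub>0 t s (\<lambda>r i. pred_fun r)\<close>.\<close>

definition id_fun :: tm where
  "id_fun = Cn (SigmaC N (N \<rightarrow> N) N) \<cdot> Cn (PiC N (N \<rightarrow> N)) \<cdot> Cn (PiC N N)"

definition pred_fun :: tm where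
  "pred_fun =
    Cn (SigmaC N (N \<rightarrow> N \<rightarrow> N) N)
      \<cdot> (Cn (SigmaC N N ((N \<rightarrow> N \<rightarrow> N) \<rightarrow> N)) \<cdot> Cn RecC \<cdot> (Cn (PiC N N) \<cdot> zero))
      \<cdot> (Cn (PiC (N \<rightarrow> N \<rightarrow> N) N) \<cdot> (Cn (PiC (N \<rightarrow> N) N) \<cdot> id_fun))"

definition monus :: "tm \<Rightarrow> tm \<Rightarrow> tm" where
  "monus s t =
    rec0 t s (Cn (SigmaC N N (N \<rightarrow> N)) \<cdot> (Cn (PiC (N \<rightarrow> N \<rightarrow> N) N) \<cdot> Cn (PiC N N)) \<cdot> pred_fun)"

definition le :: "tm \<Rightarrow> tm \<Rightarrow> fm" (infix "\<^bold>\<le>" 60) where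
  "s \<^bold>\<le> t = (monus s t \<^bold>= zero)"

definition lt :: "tm \<Rightarrow> tm \<Rightarrow> fm" (infix "\<^bold><" 60) where
  "s \<^bold>< t = (succ s \<^bold>\<le> t)"

text \<open>\<open>lift\<close> adapts the indices of a term that is moved under one more quantifier.\<close>

primrec lift :: "tm \<Rightarrow> tm" where
  "lift (Fv x) = Fv x"
| "lift (Bv i) = Bv (Suc i)"
| "lift (Cn c) = Cn c"
| "lift (s \<cdot> t) = lift s \<cdot> lift t"

text \<open>Equality is primitive at type 0 only. At a function type it is pointwise equality; finite
  sequences are equal if they have the same length and equal entries.\<close>

primrec eq :: "ty \<Rightarrow> tm \<Rightarrow> tm \<Rightarrow> fm" where
  "eq N s t = (s \<^bold>= t)"
| "eq (\<sigma> \<rightarrow> \<tau>) s t = All \<sigma> (eq \<tau> (lift s \<cdot> Bv 0) (lift t \<cdot> Bv 0))"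
| "eq (Seq \<sigma>) s t =
    ((Cn (LenC \<sigma>) \<cdot> s \<^bold>= Cn (LenC \<sigma>) \<cdot> t) \<^bold>\<and>
     All N (Bv 0 \<^bold>< Cn (LenC \<sigma>) \<cdot> lift s \<^bold>\<longrightarrow>
       eq \<sigma> (Cn (AtC \<sigma>) \<cdot> lift s \<cdot> Bv 0) (Cn (AtC \<sigma>) \<cdot> lift t \<cdot> Bv 0)))"

text \<open>\<open>s \<in> t\<close> for \<open>s\<close> of type \<open>\<sigma>\<close> and \<open>t\<close> of type \<open>\<sigma>\<^sup>*\<close>.\<close>

definition mem :: "ty \<Rightarrow> tm \<Rightarrow> tm \<Rightarrow> fm" where
  "mem \<sigma> s t =
    Ex N (Bv 0 \<^bold>< Cn (LenC \<sigma>) \<cdot> lift t \<^bold>\<and> eq \<sigma> (lift s) (Cn (AtC \<sigma>) \<cdot> lift t \<cdot> Bv 0))"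

primrec zero_ty :: "ty \<Rightarrow> tm" where
  "zero_ty N = zero"
| "zero_ty (\<sigma> \<rightarrow> \<tau>) = Cn (PiC \<tau> \<sigma>) \<cdot> zero_ty \<tau>"
| "zero_ty (Seq \<sigma>) = Cn (NilC \<sigma>)"


section \<open>Derivability\<close>

text \<open>
  Classical many-sorted natural deduction. Here \<open>T\<close> is a set of axioms and \<open>\<Gamma>\<close> the set of open
  assumptions. The eigenvariable conditions concern \<open>\<Gamma>\<close> only, so the free variables of an
  axiom in \<open>T\<close> are parameters: an axiom stands for its universal closure.
\<close>

inductive deriv :: "fm set \<Rightarrow> fm set \<Rightarrow> fm \<Rightarrow> bool" for T :: "fm set" where
  Ax: "\<phi> \<in> T \<Longrightarrow> deriv T \<Gamma> \<phi>"
| Assm: "\<phi> \<in> \<Gamma> \<Longrightarrow> deriv T \<Gamma> \<phi>"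
| Raa: "formula \<phi> \<Longrightarrow> deriv T (insert (\<^bold>\<not> \<phi>) \<Gamma>) Fls \<Longrightarrow> deriv T \<Gamma> \<phi>"
| ImpI: "formula \<phi> \<Longrightarrow> deriv T (insert \<phi> \<Gamma>) \<psi> \<Longrightarrow> deriv T \<Gamma> (\<phi> \<^bold>\<longrightarrow> \<psi>)"
| ImpE: "deriv T \<Gamma> (\<phi> \<^bold>\<longrightarrow> \<psi>) \<Longrightarrow> deriv T \<Gamma> \<phi> \<Longrightarrow> deriv T \<Gamma> \<psi>"
| ConjI: "deriv T \<Gamma> \<phi> \<Longrightarrow> deriv T \<Gamma> \<psi> \<Longrightarrow> deriv T \<Gamma> (\<phi> \<^bold>\<and> \<psi>)"
| ConjE1: "deriv T \<Gamma> (\<phi> \<^bold>\<and> \<psi>) \<Longrightarrow> deriv T \<Gamma> \<phi>"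
| ConjE2: "deriv T \<Gamma> (\<phi> \<^bold>\<and> \<psi>) \<Longrightarrow> deriv T \<Gamma> \<psi>"
| DisjI1: "formula \<psi> \<Longrightarrow> deriv T \<Gamma> \<phi> \<Longrightarrow> deriv T \<Gamma> (\<phi> \<^bold>\<or> \<psi>)"
| DisjI2: "formula \<phi> \<Longrightarrow> deriv T \<Gamma> \<psi> \<Longrightarrow> deriv T \<Gamma> (\<phi> \<^bold>\<or> \<psi>)"
| DisjE: "deriv T \<Gamma> (\<phi> \<^bold>\<or> \<psi>) \<Longrightarrow> deriv T (insert \<phi> \<Gamma>) \<chi> \<Longrightarrow> deriv T (insert \<psi> \<Gamma>) \<chi>
    \<Longrightarrow> deriv T \<Gamma> \<chi>"
| AllI: "deriv T \<Gamma> (opn 0 (Fv (n, \<sigma>)) \<phi>) \<Longrightarrow> (n, \<sigma>) \<notin> fv \<phi> \<Longrightarrow> \<forall>\<psi>\<in>\<Gamma>. (n, \<sigma>) \<notin> fv \<psi>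
    \<Longrightarrow> deriv T \<Gamma> (All \<sigma> \<phi>)"
| AllE: "deriv T \<Gamma> (All \<sigma> \<phi>) \<Longrightarrow> term_of_ty t \<sigma> \<Longrightarrow> deriv T \<Gamma> (opn 0 t \<phi>)"
| ExI: "formula (Ex \<sigma> \<phi>) \<Longrightarrow> term_of_ty t \<sigma> \<Longrightarrow> deriv T \<Gamma> (opn 0 t \<phi>) \<Longrightarrow> deriv T \<Gamma> (Ex \<sigma> \<phi>)"
| ExE: "deriv T \<Gamma> (Ex \<sigma> \<phi>) \<Longrightarrow> deriv T (insert (opn 0 (Fv (n, \<sigma>)) \<phi>) \<Gamma>) \<chi>
    \<Longrightarrow> (n, \<sigma>) \<notin> fv \<phi> \<Longrightarrow> (n, \<sigma>) \<notin> fv \<chi> \<Longrightarrow> \<forall>\<psi>\<in>\<Gamma>. (n, \<sigma>) \<notin> fv \<psi>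
    \<Longrightarrow> deriv T \<Gamma> \<chi>"

definition proves :: "fm set \<Rightarrow> fm \<Rightarrow> bool" (infix "\<tturnstile>" 50) where
  "T \<tturnstile> \<phi> \<longleftrightarrow> deriv T {} \<phi>"


section \<open>The systems\<close>

abbreviation v :: "nat \<Rightarrow> ty \<Rightarrow> tm" where "v n \<sigma> \<equiv> Fv (n, \<sigma>)"

text \<open>\<open>E-PRA\<^sup>\<omega>\<^sup>*\<close>. The axiom \<open>at_default\<close> fixes the value of entries beyond the
  length of a sequence.\<close>

inductive_set EPRA :: "fm set" where
  eq_refl: "v 0 N \<^bold>= v 0 N \<in> EPRA"
| eq_sym: "v 0 N \<^bold>= v 1 N \<^bold>\<longrightarrow> v 1 N \<^bold>= v 0 N \<in> EPRA"
| eq_trans: "v 0 N \<^bold>= v 1 N \<^bold>\<and> v 1 N \<^bold>= v 2 N \<^bold>\<longrightarrow> v 0 N \<^bold>= v 2 N \<in> EPRA"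
| ext: "eq \<rho> (v 0 \<rho>) (v 1 \<rho>) \<^bold>\<longrightarrow> eq \<tau> (v 2 (\<rho> \<rightarrow> \<tau>) \<cdot> v 0 \<rho>) (v 2 (\<rho> \<rightarrow> \<tau>) \<cdot> v 1 \<rho>) \<in> EPRA"
| succ_not_zero: "\<^bold>\<not> succ (v 0 N) \<^bold>= zero \<in> EPRA"
| succ_inj: "succ (v 0 N) \<^bold>= succ (v 1 N) \<^bold>\<longrightarrow> v 0 N \<^bold>= v 1 N \<in> EPRA"
| Pi_ax: "eq \<rho> (Cn (PiC \<rho> \<tau>) \<cdot> v 0 \<rho> \<cdot> v 1 \<tau>) (v 0 \<rho>) \<in> EPRA"
| Sigma_ax:
    "eq \<tau> (Cn (SigmaC \<delta> \<rho> \<tau>) \<cdot> v 0 (\<delta> \<rightarrow> \<rho> \<rightarrow> \<tau>) \<cdot> v 1 (\<delta> \<rightarrow> \<rho>) \<cdot> v 2 \<delta>)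
       (v 0 (\<delta> \<rightarrow> \<rho> \<rightarrow> \<tau>) \<cdot> v 2 \<delta> \<cdot> (v 1 (\<delta> \<rightarrow> \<rho>) \<cdot> v 2 \<delta>)) \<in> EPRA"
| rec_zero: "rec0 zero (v 0 N) (v 1 (N \<rightarrow> N \<rightarrow> N)) \<^bold>= v 0 N \<in> EPRA"
| rec_succ:
    "rec0 (succ (v 2 N)) (v 0 N) (v 1 (N \<rightarrow> N \<rightarrow> N)) \<^bold>=
       v 1 (N \<rightarrow> N \<rightarrow> N) \<cdot> rec0 (v 2 N) (v 0 N) (v 1 (N \<rightarrow> N \<rightarrow> N)) \<cdot> v 2 N \<in> EPRA"
| qf_ind:
    "formula \<phi> \<Longrightarrow> qf \<phi> \<Longrightarrow> snd x = N \<Longrightarrow>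
      subst x zero \<phi> \<^bold>\<and> (\<^bold>\<forall>x. (\<phi> \<^bold>\<longrightarrow> subst x (succ (Fv x)) \<phi>)) \<^bold>\<longrightarrow> (\<^bold>\<forall>x. \<phi>) \<in> EPRA"
| seq_cases:
    "eq (Seq \<sigma>) (v 0 (Seq \<sigma>)) (Cn (NilC \<sigma>)) \<^bold>\<or>
      (\<^bold>\<exists>(1, \<sigma>). \<^bold>\<exists>(2, Seq \<sigma>). eq (Seq \<sigma>) (v 0 (Seq \<sigma>)) (Cn (ConsC \<sigma>) \<cdot> v 1 \<sigma> \<cdot> v 2 (Seq \<sigma>))) \<in> EPRA"
| lrec_nil: "Cn (LRecC \<sigma>) \<cdot> Cn (NilC \<sigma>) \<cdot> v 0 N \<cdot> v 1 (N \<rightarrow> \<sigma> \<rightarrow> N) \<^bold>= v 0 N \<in> EPRA"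
| lrec_cons:
    "Cn (LRecC \<sigma>) \<cdot> (Cn (ConsC \<sigma>) \<cdot> v 2 \<sigma> \<cdot> v 3 (Seq \<sigma>)) \<cdot> v 0 N \<cdot> v 1 (N \<rightarrow> \<sigma> \<rightarrow> N) \<^bold>=
       v 1 (N \<rightarrow> \<sigma> \<rightarrow> N) \<cdot> (Cn (LRecC \<sigma>) \<cdot> v 3 (Seq \<sigma>) \<cdot> v 0 N \<cdot> v 1 (N \<rightarrow> \<sigma> \<rightarrow> N)) \<cdot> v 2 \<sigma> \<in> EPRA"
| len_nil: "Cn (LenC \<sigma>) \<cdot> Cn (NilC \<sigma>) \<^bold>= zero \<in> EPRA"
| len_cons:
    "Cn (LenC \<sigma>) \<cdot> (Cn (ConsC \<sigma>) \<cdot> v 0 \<sigma> \<cdot> v 1 (Seq \<sigma>)) \<^bold>=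
       succ (Cn (LenC \<sigma>) \<cdot> v 1 (Seq \<sigma>)) \<in> EPRA"
| at_zero: "eq \<sigma> (Cn (AtC \<sigma>) \<cdot> (Cn (ConsC \<sigma>) \<cdot> v 0 \<sigma> \<cdot> v 1 (Seq \<sigma>)) \<cdot> zero) (v 0 \<sigma>) \<in> EPRA"
| at_succ:
    "eq \<sigma> (Cn (AtC \<sigma>) \<cdot> (Cn (ConsC \<sigma>) \<cdot> v 0 \<sigma> \<cdot> v 1 (Seq \<sigma>)) \<cdot> succ (v 2 N))
       (Cn (AtC \<sigma>) \<cdot> v 1 (Seq \<sigma>) \<cdot> v 2 N) \<in> EPRA"
| at_default:
    "\<^bold>\<not> v 1 N \<^bold>< Cn (LenC \<sigma>) \<cdot> v 0 (Seq \<sigma>) \<^bold>\<longrightarrow>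
       eq \<sigma> (Cn (AtC \<sigma>) \<cdot> v 0 (Seq \<sigma>) \<cdot> v 1 N) (zero_ty \<sigma>) \<in> EPRA"
| len_tab: "Cn (LenC \<sigma>) \<cdot> (Cn (TabC \<sigma>) \<cdot> v 0 (N \<rightarrow> \<sigma>) \<cdot> v 1 N) \<^bold>= v 1 N \<in> EPRA"
| at_tab:
    "v 2 N \<^bold>< v 1 N \<^bold>\<longrightarrow>
       eq \<sigma> (Cn (AtC \<sigma>) \<cdot> (Cn (TabC \<sigma>) \<cdot> v 0 (N \<rightarrow> \<sigma>) \<cdot> v 1 N) \<cdot> v 2 N) (v 0 (N \<rightarrow> \<sigma>) \<cdot> v 2 N) \<in> EPRA"

inductive_set QF_AC10 :: "fm set" where
  "formula \<phi> \<Longrightarrow> qf \<phi> \<Longrightarrow> snd x = ty1 \<Longrightarrow> snd y = N \<Longrightarrow> snd F = ty2 \<Longrightarrow> F \<notin> fv \<phi> \<Longrightarrow>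
    (\<^bold>\<forall>x. \<^bold>\<exists>y. \<phi>) \<^bold>\<longrightarrow> (\<^bold>\<exists>F. \<^bold>\<forall>x. subst y (Fv F \<cdot> Fv x) \<phi>) \<in> QF_AC10"

inductive_set ST_ax :: "fm set" where
  st_eq: "St (v 0 \<sigma>) \<^bold>\<and> eq \<sigma> (v 0 \<sigma>) (v 1 \<sigma>) \<^bold>\<longrightarrow> St (v 1 \<sigma>) \<in> ST_ax"
| st_closed: "term_of_ty t \<sigma> \<Longrightarrow> fv_tm t = {} \<Longrightarrow> St t \<in> ST_ax"
| st_app: "St (v 0 (\<sigma> \<rightarrow> \<tau>)) \<^bold>\<and> St (v 1 \<sigma>) \<^bold>\<longrightarrow> St (v 0 (\<sigma> \<rightarrow> \<tau>) \<cdot> v 1 \<sigma>) \<in> ST_ax"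

inductive_set HAC_int :: "fm set" where
  "formula \<phi> \<Longrightarrow> internal \<phi> \<Longrightarrow> x = (i, \<sigma>) \<Longrightarrow> y = (j, \<tau>) \<Longrightarrow> x \<noteq> y \<Longrightarrow>
    F = (k, \<sigma> \<rightarrow> Seq \<tau>) \<Longrightarrow> F \<notin> fv \<phi> \<Longrightarrow>
    (\<^bold>\<forall>\<^sup>s\<^sup>tx. \<^bold>\<exists>\<^sup>s\<^sup>ty. \<phi>) \<^bold>\<longrightarrow>
    (\<^bold>\<exists>\<^sup>s\<^sup>tF. \<^bold>\<forall>\<^sup>s\<^sup>tx. \<^bold>\<exists>y. (mem \<tau> (Fv y) (Fv F \<cdot> Fv x) \<^bold>\<and> \<phi>)) \<in> HAC_int"

text \<open>Below, the bound variable \<open>z \<in> x\<close> of the informal premise of idealisation is again named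
  \<open>x\<close>, and the finite sequence is named \<open>w\<close>.\<close>

inductive_set Idealisation :: "fm set" where
  "formula \<phi> \<Longrightarrow> internal \<phi> \<Longrightarrow> x = (i, \<sigma>) \<Longrightarrow> y = (j, \<tau>) \<Longrightarrow> x \<noteq> y \<Longrightarrow>
    w = (k, Seq \<sigma>) \<Longrightarrow> w \<noteq> y \<Longrightarrow> w \<notin> fv \<phi> \<Longrightarrow>
    (\<^bold>\<forall>\<^sup>s\<^sup>tw. \<^bold>\<exists>y. \<^bold>\<forall>x. (mem \<sigma> (Fv x) (Fv w) \<^bold>\<longrightarrow> \<phi>)) \<^bold>\<longrightarrow>
    (\<^bold>\<exists>y. \<^bold>\<forall>\<^sup>s\<^sup>tx. \<phi>) \<in> Idealisation"

definition P0 :: "fm set" where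
  "P0 = EPRA \<union> QF_AC10 \<union> ST_ax \<union> HAC_int \<union> Idealisation"


section \<open>The principles\<close>

definition E2 :: fm where
  "E2 = (let x = (0, ty1); y = (1, ty1); \<phi> = (2, ty2) in
    \<^bold>\<forall>x. \<^bold>\<forall>y. \<^bold>\<forall>\<phi>. (eq ty1 (Fv x) (Fv y) \<^bold>\<longrightarrow> Fv \<phi> \<cdot> Fv x \<^bold>= Fv \<phi> \<cdot> Fv y))"

definition le2_one :: "var \<Rightarrow> fm" where
  "le2_one Y = (let f = (0, ty1) in \<^bold>\<forall>f. Fv Y \<cdot> Fv f \<^bold>\<le> succ zero)"

definition approx2 :: "var \<Rightarrow> var \<Rightarrow> fm" where
  "approx2 Z Y = (let f = (0, ty1) in \<^bold>\<forall>\<^sup>s\<^sup>tf. Fv Z \<cdot> Fv f \<^bold>= Fv Y \<cdot> Fv f)"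

definition STP2 :: fm where
  "STP2 = (let Y = (0, ty2); Z = (1, ty2) in
    \<^bold>\<forall>Y. (le2_one Y \<^bold>\<longrightarrow> (\<^bold>\<exists>\<^sup>s\<^sup>tZ. (le2_one Z \<^bold>\<and> approx2 Z Y))))"

definition Exists2 :: fm where
  "Exists2 = (let \<phi> = (0, ty2); f = (0, ty1); n = (0, N) in
    \<^bold>\<exists>\<phi>. \<^bold>\<forall>f. ((\<^bold>\<exists>n. Fv f \<cdot> Fv n \<^bold>= zero) \<^bold>\<longleftrightarrow> Fv \<phi> \<cdot> Fv f \<^bold>= zero))"

end

(* Idealisation yields a finite sequence s that contains all standard numbers. Let
   Y f be 0 if f vanishes at an entry of s, and 1 otherwise; STP2 replaces Y by a standard Z. If a
   standard f has a standard zero, then Z (min f 1) = 0. Otherwise min f 1 agrees with the constant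
   function 1 at all standard numbers, so Z (min f 1) = Z 1 = Y 1 = 1 by standard extensionality.
   Hence f |-> Z (min f 1) is standard and decides whether f has a standard zero; no transfer is
   needed.

   Derivability is reduced to truth by a Henkin construction: a formula that holds in all term
   models of the theorems of T is derivable from T. In such a model, equality of all
   types is a congruence, abstraction is available through the combinators, and quantifier-free
   induction becomes an induction over the terms of type 0. *)
theory Submission
  imports Defs "HOL-Library.Countable"
begin

section \<open>Syntax\<close>

text \<open>At the outset nothing prevents a standard \<open>f\<close> without a standard zero from
  vanishing at a nonstandard entry of the sequence, where \<open>Y\<close> would report a zero.
  Standard extensionality does not apply to \<open>Y\<close>, whose definition has a nonstandard
  parameter; this is why a standard \<open>Z\<close> is needed. Truncation makes all such
  \<open>f\<close> indistinguishable at standard arguments from one fixed function, and the constant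
  1 is chosen because it vanishes nowhere, so that the value of \<open>Y\<close> at it is certain
  whatever the other entries are. The length of the sequence may be nonstandard as well. Hence every
  fact about the search, even that its result is at most 1, has to come from induction inside the
  theory and be stated by a quantifier-free formula; this dictates the explicit predecessor and the
  sums used below. The models consist of all terms, open ones included: free variables serve as
  Henkin witnesses, so that no constants are added to the language.\<close>

lemma has_ty_Fv [simp]: "\<Delta> \<turnstile> Fv x \<triangleright> \<tau> \<longleftrightarrow> \<tau> = snd x"
  by (cases x) (auto intro: has_ty.intros elim: has_ty.cases)

lemma has_ty_Bv [simp]: "\<Delta> \<turnstile> Bv i \<triangleright> \<tau> \<longleftrightarrow> i < length \<Delta> \<and> \<tau> = \<Delta> ! i"
  by (auto intro: has_ty.intros elim: has_ty.cases)

lemma has_ty_Cn [simp]: "\<Delta> \<turnstile> Cn c \<triangleright> \<tau> \<longleftrightarrow> \<tau> = cn_ty c"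
  by (auto intro: has_ty.intros elim: has_ty.cases)

lemma has_ty_App [simp]: "\<Delta> \<turnstile> s \<cdot> t \<triangleright> \<tau> \<longleftrightarrow> (\<exists>\<sigma>. \<Delta> \<turnstile> s \<triangleright> (\<sigma> \<rightarrow> \<tau>) \<and> \<Delta> \<turnstile> t \<triangleright> \<sigma>)"
  by (auto intro: has_ty.intros elim: has_ty.cases)

lemma has_ty_append: "\<Delta> \<turnstile> t \<triangleright> \<sigma> \<Longrightarrow> \<Delta> @ \<Delta>' \<turnstile> t \<triangleright> \<sigma>"
  by (induction t arbitrary: \<sigma>) (auto simp: nth_append)

lemma has_ty_closed: "term_of_ty t \<sigma> \<Longrightarrow> \<Delta> \<turnstile> t \<triangleright> \<sigma>"
  using has_ty_append[of "[]"] by simp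

lemma has_ty_unique: "\<Delta> \<turnstile> t \<triangleright> \<sigma> \<Longrightarrow> \<Delta> \<turnstile> t \<triangleright> \<tau> \<Longrightarrow> \<sigma> = \<tau>"
  by (induction t arbitrary: \<sigma> \<tau>) fastforce+

lemma has_ty_closed_iff: "term_of_ty t \<sigma> \<Longrightarrow> \<Delta> \<turnstile> t \<triangleright> \<tau> \<longleftrightarrow> \<tau> = \<sigma>"
  using has_ty_closed has_ty_unique by blast

lemma opn_tm_id: "\<Delta> \<turnstile> t \<triangleright> \<sigma> \<Longrightarrow> length \<Delta> \<le> k \<Longrightarrow> opn_tm k u t = t"
  by (induction t arbitrary: \<sigma>) auto

lemma opn_tm_closed [simp]: "term_of_ty t \<sigma> \<Longrightarrow> opn_tm k u t = t"
  using opn_tm_id by fastforce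

lemma lift_closed [simp]: "term_of_ty t \<sigma> \<Longrightarrow> lift t = t"
  by (induction t arbitrary: \<sigma>) auto

lemma has_ty_lift: "\<Delta> \<turnstile> t \<triangleright> \<sigma> \<Longrightarrow> \<rho> # \<Delta> \<turnstile> lift t \<triangleright> \<sigma>"
  by (induction t arbitrary: \<sigma>) auto

lemma has_ty_opn:
  "\<Delta> @ [\<rho>] \<turnstile> t \<triangleright> \<sigma> \<Longrightarrow> term_of_ty u \<rho> \<Longrightarrow> \<Delta> \<turnstile> opn_tm (length \<Delta>) u t \<triangleright> \<sigma>"
  by (induction t arbitrary: \<sigma>) (auto simp: nth_append has_ty_closed)

lemma wf_opn: "wf_fm (\<Delta> @ [\<rho>]) \<phi> \<Longrightarrow> term_of_ty u \<rho> \<Longrightarrow> wf_fm \<Delta> (opn (length \<Delta>) u \<phi>)"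
proof (induction \<phi> arbitrary: \<Delta>)
  case (All \<sigma> \<phi>)
  then show ?case using All.IH[of "\<sigma> # \<Delta>"] by simp
next
  case (Ex \<sigma> \<phi>)
  then show ?case using Ex.IH[of "\<sigma> # \<Delta>"] by simp
qed (auto intro: has_ty_opn)

lemma formula_opn: "wf_fm [\<sigma>] \<phi> \<Longrightarrow> term_of_ty t \<sigma> \<Longrightarrow> formula (opn 0 t \<phi>)"
  using wf_opn[of "[]"] by simp

lemma has_ty_cls: "\<Delta> \<turnstile> t \<triangleright> \<sigma> \<Longrightarrow> \<Delta> @ [snd x] \<turnstile> cls_tm (length \<Delta>) x t \<triangleright> \<sigma>"
  by (induction t arbitrary: \<sigma>) (auto simp: nth_append)

lemma wf_cls: "wf_fm \<Delta> \<phi> \<Longrightarrow> wf_fm (\<Delta> @ [snd x]) (cls (length \<Delta>) x \<phi>)"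
proof (induction \<phi> arbitrary: \<Delta>)
  case (All \<sigma> \<phi>)
  then show ?case using All.IH[of "\<sigma> # \<Delta>"] by simp
next
  case (Ex \<sigma> \<phi>)
  then show ?case using Ex.IH[of "\<sigma> # \<Delta>"] by simp
qed (auto intro: has_ty_cls)

lemma formula_all_v [simp]: "formula \<phi> \<Longrightarrow> formula (\<^bold>\<forall>x. \<phi>)"
  using wf_cls[of "[]"] by (simp add: all_v_def)

lemma formula_ex_v [simp]: "formula \<phi> \<Longrightarrow> formula (\<^bold>\<exists>x. \<phi>)"
  using wf_cls[of "[]"] by (simp add: ex_v_def)

lemma opn_cls_tm: "\<Delta> \<turnstile> t \<triangleright> \<sigma> \<Longrightarrow> length \<Delta> \<le> k \<Longrightarrow> opn_tm k (Fv x) (cls_tm k x t) = t"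
  by (induction t arbitrary: \<sigma>) auto

lemma opn_cls_wf: "wf_fm \<Delta> \<phi> \<Longrightarrow> length \<Delta> \<le> k \<Longrightarrow> opn k (Fv x) (cls k x \<phi>) = \<phi>"
  by (induction \<phi> arbitrary: \<Delta> k) (fastforce intro: opn_cls_tm)+

lemma opn_cls: "formula \<phi> \<Longrightarrow> opn 0 (Fv x) (cls 0 x \<phi>) = \<phi>"
  by (rule opn_cls_wf) auto

lemma fv_cls_tm: "fv_tm (cls_tm k x t) = fv_tm t - {x}"
  by (induction t) auto

lemma fv_cls: "fv (cls k x \<phi>) = fv \<phi> - {x}"
  by (induction \<phi> arbitrary: k) (auto simp: fv_cls_tm)

lemma fv_all_v: "fv (\<^bold>\<forall>x. \<phi>) = fv \<phi> - {x}"
  by (simp add: all_v_def fv_cls)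

lemma finite_fv_tm [simp]: "finite (fv_tm t)"
  by (induction t) auto

lemma finite_fv [simp]: "finite (fv \<phi>)"
  by (induction \<phi>) auto

lemma fresh_var:
  assumes "finite A"
  obtains n where "(n, \<sigma>) \<notin> (A :: var set)"
proof -
  have "infinite ((\<lambda>n. (n, \<sigma>)) ` (UNIV :: nat set))"
    by (subst finite_image_iff) (auto simp: inj_on_def)
  then have "\<not> (\<lambda>n. (n, \<sigma>)) ` UNIV \<subseteq> A" using assms finite_subset by blast
  then show thesis using that by blast
qed


section \<open>Completeness for term models\<close>

text \<open>The measure for the recursion of \<open>sat\<close> and for the truth lemma. An instance
  \<open>opn 0 t \<phi>\<close> is not a subformula of the quantified formula and may be larger;
  counting connectives and quantifiers only ignores the size of the inserted term.\<close>

primrec depth :: "fm \<Rightarrow> nat" where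
  "depth Fls = 0"
| "depth (s \<^bold>= t) = 0"
| "depth (St t) = 0"
| "depth (\<phi> \<^bold>\<and> \<psi>) = Suc (depth \<phi> + depth \<psi>)"
| "depth (\<phi> \<^bold>\<or> \<psi>) = Suc (depth \<phi> + depth \<psi>)"
| "depth (\<phi> \<^bold>\<longrightarrow> \<psi>) = Suc (depth \<phi> + depth \<psi>)"
| "depth (All \<sigma> \<phi>) = Suc (depth \<phi>)"
| "depth (Ex \<sigma> \<phi>) = Suc (depth \<phi>)"

lemma depth_opn [simp]: "depth (opn k u \<phi>) = depth \<phi>"
  by (induction \<phi> arbitrary: k) auto

text \<open>Truth when the domain of each type consists of its terms, and \<open>Q\<close>, \<open>S\<close> interpret the
  prime formulas.\<close>

function sat :: "(tm \<Rightarrow> tm \<Rightarrow> bool) \<Rightarrow> (tm \<Rightarrow> bool) \<Rightarrow> fm \<Rightarrow> bool" where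
  "sat Q S Fls \<longleftrightarrow> False"
| "sat Q S (s \<^bold>= t) \<longleftrightarrow> Q s t"
| "sat Q S (St t) \<longleftrightarrow> S t"
| "sat Q S (\<phi> \<^bold>\<and> \<psi>) \<longleftrightarrow> sat Q S \<phi> \<and> sat Q S \<psi>"
| "sat Q S (\<phi> \<^bold>\<or> \<psi>) \<longleftrightarrow> sat Q S \<phi> \<or> sat Q S \<psi>"
| "sat Q S (\<phi> \<^bold>\<longrightarrow> \<psi>) \<longleftrightarrow> (sat Q S \<phi> \<longrightarrow> sat Q S \<psi>)"
| "sat Q S (All \<sigma> \<phi>) \<longleftrightarrow> (\<forall>t. term_of_ty t \<sigma> \<longrightarrow> sat Q S (opn 0 t \<phi>))"
| "sat Q S (Ex \<sigma> \<phi>) \<longleftrightarrow> (\<exists>t. term_of_ty t \<sigma> \<and> sat Q S (opn 0 t \<phi>))"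
  by pat_completeness auto
termination by (relation "measure (\<lambda>(Q, S, \<phi>). depth \<phi>)") auto

text \<open>Countability provides the enumeration of formulas along which the Henkin construction
  proceeds.\<close>

instance ty :: countable by countable_datatype
instance cn :: countable by countable_datatype
instance tm :: countable by countable_datatype
instance fm :: countable by countable_datatype

section \<open>Replacing a theory by its closed theorems\<close>

definition closed_thms :: "fm set \<Rightarrow> fm set" where
  "closed_thms T = {\<phi>. formula \<phi> \<and> fv \<phi> = {} \<and> deriv T {} \<phi>}"

text \<open>Only closed theorems can be moved under assumptions: the rule \<open>AllI\<close> is not applicable to
  a parameter of an axiom that is free in an assumption, so \<open>deriv T\<close> does not admit weakening.\<close>

lemma deriv_closed_thms_context:
  "deriv (closed_thms T) \<Gamma> \<phi> \<Longrightarrow>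
    \<forall>\<^sub>F C in finite_subsets_at_top (closed_thms T). deriv {} (C \<union> \<Gamma>) \<phi>"
proof (induction rule: deriv.induct)
  case (Ax \<phi> \<Gamma>)
  then show ?case
    unfolding eventually_finite_subsets_at_top by (intro exI[of _ "{\<phi>}"]) (auto intro: deriv.Assm)
next
  case (Assm \<phi> \<Gamma>)
  then show ?case by (simp add: deriv.Assm)
next
  case (Raa \<phi> \<Gamma>)
  from Raa.IH show ?case
    by eventually_elim (use Raa.hyps in \<open>auto intro: deriv.Raa\<close>)
next
  case (ImpI \<phi> \<Gamma> \<psi>)
  from ImpI.IH show ?case
    by eventually_elim (use ImpI.hyps in \<open>auto intro: deriv.ImpI\<close>)
next
  case (ImpE \<Gamma> \<phi> \<psi>)
  \<comment> \<open>The two premises may use different closed theorems; along the filter, one large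
    enough finite \<open>C\<close> serves both.\<close>
  from ImpE.IH show ?case by eventually_elim (rule deriv.ImpE)
next
  case (ConjI \<Gamma> \<phi> \<psi>)
  from ConjI.IH show ?case by eventually_elim (rule deriv.ConjI)
next
  case (ConjE1 \<Gamma> \<phi> \<psi>)
  from ConjE1.IH show ?case by eventually_elim (rule deriv.ConjE1)
next
  case (ConjE2 \<Gamma> \<phi> \<psi>)
  from ConjE2.IH show ?case by eventually_elim (rule deriv.ConjE2)
next
  case (DisjI1 \<psi> \<Gamma> \<phi>)
  from DisjI1.IH show ?case by eventually_elim (rule deriv.DisjI1[OF DisjI1.hyps(1)])
next
  case (DisjI2 \<phi> \<Gamma> \<psi>)
  from DisjI2.IH show ?case by eventually_elim (rule deriv.DisjI2[OF DisjI2.hyps(1)])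
next
  case (DisjE \<Gamma> \<phi> \<psi> \<chi>)
  from DisjE.IH show ?case by eventually_elim (rule deriv.DisjE; simp)
next
  case (AllI \<Gamma> n \<sigma> \<phi>)
  have "\<forall>\<^sub>F C in finite_subsets_at_top (closed_thms T). C \<subseteq> closed_thms T" by blast
  with AllI.IH show ?case
    by eventually_elim (rule deriv.AllI; use AllI.hyps in \<open>auto simp: closed_thms_def\<close>)
next
  case (AllE \<Gamma> \<sigma> \<phi> t)
  from AllE.IH show ?case by eventually_elim (rule deriv.AllE[OF _ AllE.hyps(2)])
next
  case (ExI \<sigma> \<phi> t \<Gamma>)
  from ExI.IH show ?case by eventually_elim (rule deriv.ExI[OF ExI.hyps(1,2)])
next
  case (ExE \<Gamma> \<sigma> \<phi> n \<chi>)
  have "\<forall>\<^sub>F C in finite_subsets_at_top (closed_thms T). C \<subseteq> closed_thms T" by blast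
  with ExE.IH show ?case
    by eventually_elim
      (rule deriv.ExE[of _ _ \<sigma> \<phi> n]; use ExE.hyps in \<open>auto simp: closed_thms_def\<close>)
qed

lemma deriv_mono: "deriv T \<Gamma> \<phi> \<Longrightarrow> T \<subseteq> T' \<Longrightarrow> deriv T' \<Gamma> \<phi>"
  by (induction rule: deriv.induct) (auto intro: deriv.intros)

text \<open>Each assumption is moved into an implication, which the induction carries to the empty
  context; there it meets the derivation of the assumption itself, so nothing has to be
  weakened.\<close>

lemma deriv_cut:
  "finite C \<Longrightarrow> C \<subseteq> closed_thms T \<Longrightarrow> deriv T C \<phi> \<Longrightarrow> deriv T {} \<phi>"
proof (induction C arbitrary: \<phi> rule: finite_induct)
  case (insert \<psi> C)
  then have "deriv T C (\<psi> \<^bold>\<longrightarrow> \<phi>)" by (auto simp: closed_thms_def intro: deriv.ImpI)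
  with insert have "deriv T {} (\<psi> \<^bold>\<longrightarrow> \<phi>)" by blast
  moreover have "deriv T {} \<psi>" using insert.prems by (simp add: closed_thms_def)
  ultimately show ?case by (rule deriv.ImpE)
qed

lemma deriv_closed_thms:
  assumes "deriv (closed_thms T) {} \<phi>"
  shows "deriv T {} \<phi>"
proof -
  obtain C where C: "finite C" "C \<subseteq> closed_thms T" "deriv {} C \<phi>"
    using deriv_closed_thms_context[OF assms] unfolding eventually_finite_subsets_at_top by auto
  then show ?thesis using deriv_mono deriv_cut by blast
qed

lemma deriv_contradiction: "\<phi> \<in> \<Gamma> \<Longrightarrow> (\<^bold>\<not> \<phi>) \<in> \<Gamma> \<Longrightarrow> deriv T \<Gamma> Fls"
  by (rule deriv.ImpE[OF deriv.Assm deriv.Assm])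

section \<open>Henkin extensions and the truth lemma\<close>

text \<open>A formula counts as decided only together with a witness: an instance of an accepted
  existential formula, a counterexample to a rejected universal one.\<close>

definition decides :: "fm \<Rightarrow> fm set \<Rightarrow> bool" where
  "decides \<phi> \<Delta> \<longleftrightarrow>
    \<phi> \<in> \<Delta> \<and> (\<forall>\<sigma> \<psi>. \<phi> = Ex \<sigma> \<psi> \<longrightarrow> (\<exists>n. opn 0 (v n \<sigma>) \<psi> \<in> \<Delta>)) \<or>
    (\<^bold>\<not> \<phi>) \<in> \<Delta> \<and> (\<forall>\<sigma> \<psi>. \<phi> = All \<sigma> \<psi> \<longrightarrow> (\<exists>n. (\<^bold>\<not> opn 0 (v n \<sigma>) \<psi>) \<in> \<Delta>))"

text \<open>If \<Gamma> were inconsistent with \<phi> and with its negation, reductio and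
  implication introduction would make \<Gamma> inconsistent. Finiteness of \<Gamma> leaves a fresh
  variable as witness, which \<open>ExE\<close>, or reductio followed by \<open>AllI\<close>,
  removes from any contradiction.\<close>

lemma consistent_extension:
  assumes "finite \<Gamma>" "\<not> deriv T \<Gamma> Fls" "formula \<phi>"
  shows "\<exists>\<Delta>. \<Gamma> \<subseteq> \<Delta> \<and> finite \<Delta> \<and> \<not> deriv T \<Delta> Fls \<and> decides \<phi> \<Delta>"
proof (cases "deriv T (insert \<phi> \<Gamma>) Fls")
  case False
  show ?thesis
  proof (cases "\<exists>\<sigma> \<psi>. \<phi> = Ex \<sigma> \<psi>")
    case True
    then obtain \<sigma> \<psi> where \<phi>: "\<phi> = Ex \<sigma> \<psi>" by blast
    obtain n where "(n, \<sigma>) \<notin> \<Union> (fv ` insert \<phi> \<Gamma>)"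
      using fresh_var[of "\<Union> (fv ` insert \<phi> \<Gamma>)"] assms(1) by auto
    then have n: "(n, \<sigma>) \<notin> fv \<psi>" "\<forall>\<psi> \<in> insert \<phi> \<Gamma>. (n, \<sigma>) \<notin> fv \<psi>" by (auto simp: \<phi> decides_def)
    have "\<not> deriv T (insert (opn 0 (v n \<sigma>) \<psi>) (insert \<phi> \<Gamma>)) Fls"
    proof
      assume "deriv T (insert (opn 0 (v n \<sigma>) \<psi>) (insert \<phi> \<Gamma>)) Fls"
      then have "deriv T (insert \<phi> \<Gamma>) Fls"
        using n deriv.ExE[of T "insert \<phi> \<Gamma>" \<sigma> \<psi> n Fls] by (auto simp: \<phi> intro: deriv.Assm)
      with False show False ..
    qed
    then show ?thesis
      using assms(1) by (intro exI[of _ "insert (opn 0 (v n \<sigma>) \<psi>) (insert \<phi> \<Gamma>)"]) (auto simp: \<phi> decides_def)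
  next
    case no_Ex: False
    with False show ?thesis using assms(1) by (intro exI[of _ "insert \<phi> \<Gamma>"]) (auto simp: decides_def)
  qed
next
  case True
  have neg: "\<not> deriv T (insert (\<^bold>\<not> \<phi>) \<Gamma>) Fls"
  proof
    assume "deriv T (insert (\<^bold>\<not> \<phi>) \<Gamma>) Fls"
    then have "deriv T \<Gamma> \<phi>" by (rule deriv.Raa[OF assms(3)])
    moreover have "deriv T \<Gamma> (\<^bold>\<not> \<phi>)" using deriv.ImpI[OF assms(3) True] .
    ultimately show False using assms(2) deriv.ImpE by blast
  qed
  show ?thesis
  proof (cases "\<exists>\<sigma> \<psi>. \<phi> = All \<sigma> \<psi>")
    case True
    then obtain \<sigma> \<psi> where \<phi>: "\<phi> = All \<sigma> \<psi>" by blast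
    let ?\<Gamma> = "insert (\<^bold>\<not> \<phi>) \<Gamma>"
    obtain n where "(n, \<sigma>) \<notin> \<Union> (fv ` ?\<Gamma>)"
      using fresh_var[of "\<Union> (fv ` ?\<Gamma>)"] assms(1) by auto
    then have n: "(n, \<sigma>) \<notin> fv \<psi>" "\<forall>\<psi> \<in> ?\<Gamma>. (n, \<sigma>) \<notin> fv \<psi>" by (auto simp: \<phi> decides_def)
    have "formula (opn 0 (v n \<sigma>) \<psi>)" using assms(3) by (auto simp: \<phi> intro: formula_opn)
    then have "\<not> deriv T (insert (\<^bold>\<not> opn 0 (v n \<sigma>) \<psi>) ?\<Gamma>) Fls"
      using n neg deriv.Raa[of "opn 0 (v n \<sigma>) \<psi>" T ?\<Gamma>] deriv.AllI[of T ?\<Gamma> n \<sigma> \<psi>]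
        deriv.ImpE[of T ?\<Gamma> \<phi> Fls] deriv.Assm[of "\<^bold>\<not> \<phi>" ?\<Gamma> T] by (auto simp: \<phi> decides_def)
    then show ?thesis
      using assms(1) by (intro exI[of _ "insert (\<^bold>\<not> opn 0 (v n \<sigma>) \<psi>) ?\<Gamma>"]) (auto simp: \<phi> decides_def)
  next
    case False
    with neg show ?thesis using assms(1) by (intro exI[of _ "insert (\<^bold>\<not> \<phi>) \<Gamma>"]) (auto simp: decides_def)
  qed
qed

lemma term_model:
  assumes "finite \<Gamma>" "\<not> deriv T \<Gamma> Fls" "\<forall>\<phi> \<in> T \<union> \<Gamma>. formula \<phi>"
  shows "\<exists>Q S. \<forall>\<phi> \<in> T \<union> \<Gamma>. sat Q S \<phi>"
proof -
  let ?C = "\<lambda>\<Delta>. finite \<Delta> \<and> \<Gamma> \<subseteq> \<Delta> \<and> \<not> deriv T \<Delta> Fls"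
  \<comment> \<open>Step \<open>n\<close> decides the formula with code \<open>n\<close>; by
    \<open>?C\<close> every stage stays finite, so fresh variables never run out.\<close>
  let ?step = "\<lambda>n \<Delta> \<Delta>'. \<Delta> \<subseteq> \<Delta>' \<and> (formula (from_nat n) \<longrightarrow> decides (from_nat n) \<Delta>')"
  have step: "\<exists>y. ?C y \<and> ?step n x y" if x: "?C x" for x n
  proof (cases "formula (from_nat n)")
    case True
    then obtain y where "x \<subseteq> y" "finite y" "\<not> deriv T y Fls" "decides (from_nat n) y"
      using consistent_extension[of x T "from_nat n"] x by blast
    then show ?thesis using x by (intro exI[of _ y]) auto
  qed (use x in blast)
  have "\<exists>\<Delta>. \<forall>n. ?C (\<Delta> n) \<and> ?step n (\<Delta> n) (\<Delta> (Suc n))"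
  proof (rule dependent_nat_choice)
    show "\<exists>\<Delta>. ?C \<Delta>" using assms by blast
    show "\<exists>y. ?C y \<and> ?step n x y" if "?C x" for x n using step[OF that] .
  qed
  then obtain \<Delta> where \<Delta>: "\<And>n. ?C (\<Delta> n)" and mono1: "\<And>n. \<Delta> n \<subseteq> \<Delta> (Suc n)"
    and dec: "\<And>n. formula (from_nat n) \<Longrightarrow> decides (from_nat n) (\<Delta> (Suc n))" by blast
  have mono: "m \<le> n \<Longrightarrow> \<Delta> m \<subseteq> \<Delta> n" for m n using mono1 by (rule lift_Suc_mono_le)
  define G where "G = (\<Union>n. \<Delta> n)"
  have dec': "\<exists>n. decides \<phi> (\<Delta> n)" if "formula \<phi>" for \<phi>
    using dec[of "to_nat \<phi>"] that by auto
  have joint: "\<exists>n. A \<subseteq> \<Delta> n" if "finite A" "A \<subseteq> G" for A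
    using that
  proof (induction A rule: finite_induct)
    case (insert \<phi> A)
    then obtain m n where "A \<subseteq> \<Delta> m" "\<phi> \<in> \<Delta> n" by (auto simp: G_def)
    then show ?case using mono[of m "max m n"] mono[of n "max m n"]
      by (intro exI[of _ "max m n"]) auto
  qed simp
  have cons: "\<phi> \<notin> G \<or> (\<^bold>\<not> \<phi>) \<notin> G" for \<phi>
    using joint[of "{\<phi>, \<^bold>\<not> \<phi>}"] \<Delta> by (auto dest: deriv_contradiction[where T = T])
  have G_neg: "(\<^bold>\<not> \<phi>) \<in> G \<longleftrightarrow> \<phi> \<notin> G" if "formula \<phi>" for \<phi>
    using dec'[OF that] cons[of \<phi>] by (auto simp: decides_def G_def)
  \<comment> \<open>Membership in \<open>G\<close> is gained at a stage that may contain much more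
    than \<open>A\<close>. As weakening is not at hand, derivability is demanded from every superset
    of \<open>A\<close>; each use below gives a derivation that is uniform in the superset.\<close>
  have closure: "\<phi> \<in> G"
    if A: "finite A" "A \<subseteq> G" "formula \<phi>" "\<And>\<Delta>. A \<subseteq> \<Delta> \<Longrightarrow> deriv T \<Delta> \<phi>" for A \<phi>
  proof (rule ccontr)
    assume "\<phi> \<notin> G"
    then have "insert (\<^bold>\<not> \<phi>) A \<subseteq> G" using G_neg A by auto
    then obtain n where "insert (\<^bold>\<not> \<phi>) A \<subseteq> \<Delta> n" using joint[of "insert (\<^bold>\<not> \<phi>) A"] A(1) by auto
    then have "deriv T (\<Delta> n) Fls" by (intro deriv.ImpE[OF deriv.Assm[of "\<^bold>\<not> \<phi>"] A(4)]) auto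
    with \<Delta> show False by blast
  qed
  have G_Fls: "Fls \<notin> G" using \<Delta> by (auto simp: G_def intro: deriv.Assm)
  define Q S where "Q = (\<lambda>s t. (s \<^bold>= t) \<in> G)" and "S = (\<lambda>t. St t \<in> G)"
  have truth: "formula \<phi> \<Longrightarrow> sat Q S \<phi> \<longleftrightarrow> \<phi> \<in> G" for \<phi>
  proof (induction \<phi> rule: measure_induct_rule[of depth])
    case (less \<phi>)
    show ?case
    proof (cases \<phi>)
      case Fls
      then show ?thesis using G_Fls by simp
    next
      case (Eq s t)
      then show ?thesis by (simp add: Q_def)
    next
      case (St t)
      then show ?thesis by (simp add: S_def)
    next
      case (Conj \<psi> \<chi>)
      then have f: "formula \<psi>" "formula \<chi>" using less.prems by auto
      have "\<phi> \<in> G \<longleftrightarrow> \<psi> \<in> G \<and> \<chi> \<in> G"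
      proof (intro iffI conjI)
        assume *: "\<phi> \<in> G"
        show "\<psi> \<in> G"
          by (rule closure[of "{\<phi>}"])
            (use * f Conj in \<open>auto intro: deriv.ConjE1[OF deriv.Assm]\<close>)
        show "\<chi> \<in> G"
          by (rule closure[of "{\<phi>}"])
            (use * f Conj in \<open>auto intro: deriv.ConjE2[OF deriv.Assm]\<close>)
      next
        assume *: "\<psi> \<in> G \<and> \<chi> \<in> G"
        show "\<phi> \<in> G"
          by (rule closure[of "{\<psi>, \<chi>}"])
            (use * f Conj in \<open>auto intro: deriv.ConjI deriv.Assm\<close>)
      qed
      then show ?thesis using less.IH f Conj by simp
    next
      case (Disj \<psi> \<chi>)
      then have f: "formula \<psi>" "formula \<chi>" using less.prems by auto
      have "\<phi> \<in> G \<longleftrightarrow> \<psi> \<in> G \<or> \<chi> \<in> G"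
      proof
        assume *: "\<phi> \<in> G"
        show "\<psi> \<in> G \<or> \<chi> \<in> G"
        proof (rule ccontr)
          assume "\<not> (\<psi> \<in> G \<or> \<chi> \<in> G)"
          then have n: "(\<^bold>\<not> \<psi>) \<in> G" "(\<^bold>\<not> \<chi>) \<in> G" using G_neg f by auto
          have "deriv T \<Delta> Fls" if "{\<phi>, \<^bold>\<not> \<psi>, \<^bold>\<not> \<chi>} \<subseteq> \<Delta>" for \<Delta>
            by (rule deriv.DisjE[of _ _ \<psi> \<chi>])
              (use that Disj in \<open>auto intro: deriv.Assm deriv_contradiction\<close>)
          then have "Fls \<in> G" by (intro closure[of "{\<phi>, \<^bold>\<not> \<psi>, \<^bold>\<not> \<chi>}"]) (use * n in auto)
          with G_Fls show False ..
        qed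
      next
        assume "\<psi> \<in> G \<or> \<chi> \<in> G"
        then show "\<phi> \<in> G"
        proof
          assume *: "\<psi> \<in> G"
          show ?thesis
            by (rule closure[of "{\<psi>}"]) (use * f Disj in \<open>auto intro: deriv.DisjI1 deriv.Assm\<close>)
        next
          assume *: "\<chi> \<in> G"
          show ?thesis
            by (rule closure[of "{\<chi>}"]) (use * f Disj in \<open>auto intro: deriv.DisjI2 deriv.Assm\<close>)
        qed
      qed
      then show ?thesis using less.IH f Disj by simp
    next
      case (Imp \<psi> \<chi>)
      then have f: "formula \<psi>" "formula \<chi>" using less.prems by auto
      have "\<phi> \<in> G \<longleftrightarrow> (\<psi> \<in> G \<longrightarrow> \<chi> \<in> G)"
      proof (intro iffI impI)
        assume *: "\<phi> \<in> G" "\<psi> \<in> G"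
        show "\<chi> \<in> G"
          by (rule closure[of "{\<phi>, \<psi>}"])
            (use * f Imp in \<open>auto intro: deriv.ImpE[OF deriv.Assm deriv.Assm]\<close>)
      next
        assume *: "\<psi> \<in> G \<longrightarrow> \<chi> \<in> G"
        show "\<phi> \<in> G"
        proof (cases "\<chi> \<in> G")
          case True
          show ?thesis
            by (rule closure[of "{\<chi>}"])
              (use True f Imp in \<open>auto intro: deriv.ImpI deriv.Assm\<close>)
        next
          case False
          then have n: "(\<^bold>\<not> \<psi>) \<in> G" using * G_neg f by auto
          have "deriv T \<Delta> \<phi>" if "{\<^bold>\<not> \<psi>} \<subseteq> \<Delta>" for \<Delta>
            unfolding Imp
            by (rule deriv.ImpI[OF f(1) deriv.Raa[OF f(2) deriv_contradiction[of \<psi>]]])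
              (use that in auto)
          then show ?thesis by (intro closure[of "{\<^bold>\<not> \<psi>}"]) (use n less.prems in auto)
        qed
      qed
      then show ?thesis using less.IH f Imp by simp
    next
      case (All \<sigma> \<psi>)
      then have f: "formula (opn 0 t \<psi>)" if "term_of_ty t \<sigma>" for t
        using less.prems that formula_opn by auto
      have "\<phi> \<in> G \<longleftrightarrow> (\<forall>t. term_of_ty t \<sigma> \<longrightarrow> opn 0 t \<psi> \<in> G)"
      proof (intro iffI allI impI)
        fix t assume *: "\<phi> \<in> G" "term_of_ty t \<sigma>"
        show "opn 0 t \<psi> \<in> G"
          by (rule closure[of "{\<phi>}"]) (use * f All in \<open>auto intro: deriv.AllE[OF deriv.Assm]\<close>)
      next
        assume *: "\<forall>t. term_of_ty t \<sigma> \<longrightarrow> opn 0 t \<psi> \<in> G"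
        show "\<phi> \<in> G"
        proof (rule ccontr)
          assume no: "\<phi> \<notin> G"
          obtain m where "decides \<phi> (\<Delta> m)" using dec' less.prems by blast
          then obtain n where "(\<^bold>\<not> opn 0 (v n \<sigma>) \<psi>) \<in> G"
            using no All unfolding decides_def G_def by blast
          moreover have "opn 0 (v n \<sigma>) \<psi> \<in> G" using * by simp
          ultimately show False using cons by blast
        qed
      qed
      then show ?thesis using less.IH f All by auto
    next
      case (Ex \<sigma> \<psi>)
      then have f: "formula (opn 0 t \<psi>)" if "term_of_ty t \<sigma>" for t
        using less.prems that formula_opn by auto
      have "\<phi> \<in> G \<longleftrightarrow> (\<exists>t. term_of_ty t \<sigma> \<and> opn 0 t \<psi> \<in> G)"
      proof
        assume *: "\<phi> \<in> G"
        obtain m where "decides \<phi> (\<Delta> m)" using dec' less.prems by blast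
        moreover have "(\<^bold>\<not> \<phi>) \<notin> G" using * cons by blast
        ultimately obtain n where "opn 0 (v n \<sigma>) \<psi> \<in> G"
          using Ex unfolding decides_def G_def by blast
        then show "\<exists>t. term_of_ty t \<sigma> \<and> opn 0 t \<psi> \<in> G" by (intro exI[of _ "v n \<sigma>"]) simp
      next
        assume "\<exists>t. term_of_ty t \<sigma> \<and> opn 0 t \<psi> \<in> G"
        then obtain t where *: "term_of_ty t \<sigma>" "opn 0 t \<psi> \<in> G" by blast
        show "\<phi> \<in> G"
          by (rule closure[of "{opn 0 t \<psi>}"])
            (use * less.prems Ex in \<open>auto intro: deriv.ExI deriv.Assm\<close>)
      qed
      then show ?thesis using less.IH f Ex by auto
    qed
  qed
  have "\<phi> \<in> G" if "\<phi> \<in> T \<union> \<Gamma>" for \<phi>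
  proof (cases "\<phi> \<in> T")
    case True
    then show ?thesis using closure[of "{}" \<phi>] assms(3) by (auto intro: deriv.Ax)
  next
    case False
    then show ?thesis using that \<Delta>[of 0] by (auto simp: G_def)
  qed
  then show ?thesis using truth assms(3) by blast
qed

section \<open>From term models to derivability\<close>

lemma proves_all_v:
  assumes "T \<tturnstile> \<phi>" "formula \<phi>"
  shows "T \<tturnstile> \<^bold>\<forall>x. \<phi>"
  unfolding proves_def all_v_def
proof (rule deriv.AllI[where n = "fst x"])
  show "deriv T {} (opn 0 (Fv (fst x, snd x)) (cls 0 x \<phi>))"
    using assms by (simp add: opn_cls proves_def)
qed (auto simp: fv_cls)

text \<open>A free variable is itself an element of the domain. Generalising over it lowers the
  number of free variables, and instantiating with the same variable gives back the formula.\<close>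

lemma sat_theorem:
  assumes closed: "\<forall>\<phi> \<in> closed_thms T. sat Q S \<phi>" and "T \<tturnstile> \<phi>" "formula \<phi>"
  shows "sat Q S \<phi>"
  using assms(2,3)
proof (induction "card (fv \<phi>)" arbitrary: \<phi>)
  case 0
  then show ?case using closed by (auto simp: closed_thms_def proves_def)
next
  case (Suc n)
  then obtain x where x: "x \<in> fv \<phi>" by (metis card.empty ex_in_conv nat.distinct(1))
  have "n = card (fv (\<^bold>\<forall>x. \<phi>))" using Suc.hyps(2) x by (simp add: fv_all_v)
  then have "sat Q S (\<^bold>\<forall>x. \<phi>)"
    using Suc.hyps(1) proves_all_v[OF Suc.prems] formula_all_v[OF Suc.prems(2)] by blast
  moreover have "term_of_ty (Fv x) (snd x)" by simp
  ultimately have "sat Q S (opn 0 (Fv x) (cls 0 x \<phi>))" unfolding all_v_def sat.simps by blast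
  then show ?case using Suc.prems by (simp add: opn_cls)
qed

text \<open>The models in \<open>valid\<close> satisfy all well-formed theorems, not merely the
  axioms. Parameters of an axiom can therefore be quantified inside the calculus before evaluation,
  and no soundness proof for \<open>sat\<close> is required.\<close>

theorem completeness:
  assumes "formula \<chi>"
    and valid: "\<And>Q S. (\<And>\<phi>. T \<tturnstile> \<phi> \<Longrightarrow> formula \<phi> \<Longrightarrow> sat Q S \<phi>) \<Longrightarrow> sat Q S \<chi>"
  shows "T \<tturnstile> \<chi>"
proof (rule ccontr)
  assume no: "\<not> T \<tturnstile> \<chi>"
  have "\<not> deriv (closed_thms T) {\<^bold>\<not> \<chi>} Fls"
  proof
    assume "deriv (closed_thms T) {\<^bold>\<not> \<chi>} Fls"
    then have "deriv T {} \<chi>" by (rule deriv_closed_thms[OF deriv.Raa[OF assms(1)]])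
    with no show False by (simp add: proves_def)
  qed
  moreover have "\<forall>\<phi> \<in> closed_thms T \<union> {\<^bold>\<not> \<chi>}. formula \<phi>"
    using assms(1) by (auto simp: closed_thms_def)
  ultimately obtain Q S where *: "\<forall>\<phi> \<in> closed_thms T \<union> {\<^bold>\<not> \<chi>}. sat Q S \<phi>"
    using term_model[of "{\<^bold>\<not> \<chi>}" "closed_thms T"] by blast
  have "sat Q S \<chi>"
  proof (rule valid)
    fix \<phi> assume "T \<tturnstile> \<phi>" "formula \<phi>"
    with * show "sat Q S \<phi>" by (intro sat_theorem[of T]) blast+
  qed
  with * show False by simp
qed

section \<open>Equality and combinators in term models of E-PRA\<close>

lemma has_ty_id_fun [simp]: "\<Delta> \<turnstile> id_fun \<triangleright> \<tau> \<longleftrightarrow> \<tau> = N \<rightarrow> N"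
  by (auto simp: id_fun_def)

lemma has_ty_pred_fun [simp]: "\<Delta> \<turnstile> pred_fun \<triangleright> \<tau> \<longleftrightarrow> \<tau> = N \<rightarrow> N"
  by (auto simp: pred_fun_def)

lemma has_ty_monus [simp]: "\<Delta> \<turnstile> monus s t \<triangleright> \<tau> \<longleftrightarrow> \<tau> = N \<and> \<Delta> \<turnstile> s \<triangleright> N \<and> \<Delta> \<turnstile> t \<triangleright> N"
  by (auto simp: monus_def)

lemma cls_tm_pred_fun [simp]: "cls_tm k x pred_fun = pred_fun"
  by (simp add: pred_fun_def id_fun_def)

lemma opn_tm_pred_fun [simp]: "opn_tm k u pred_fun = pred_fun"
  by (rule opn_tm_closed[of _ "N \<rightarrow> N"]) simp

lemma cls_tm_monus [simp]: "cls_tm k x (monus s t) = monus (cls_tm k x s) (cls_tm k x t)"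
  by (simp add: monus_def)

lemma opn_tm_monus [simp]: "opn_tm k u (monus s t) = monus (opn_tm k u s) (opn_tm k u t)"
  by (simp add: monus_def)

lemma cls_tm_lift [simp]: "cls_tm (Suc k) x (lift t) = lift (cls_tm k x t)"
  by (induction t) auto

lemma opn_tm_lift [simp]: "term_of_ty u \<rho> \<Longrightarrow> opn_tm (Suc k) u (lift t) = lift (opn_tm k u t)"
  by (induction t) auto

lemma cls_eq [simp]: "cls k x (eq \<tau> s t) = eq \<tau> (cls_tm k x s) (cls_tm k x t)"
  by (induction \<tau> arbitrary: k s t) (auto simp: lt_def le_def)

lemma opn_eq [simp]:
  "term_of_ty u \<rho> \<Longrightarrow> opn k u (eq \<tau> s t) = eq \<tau> (opn_tm k u s) (opn_tm k u t)"
  by (induction \<tau> arbitrary: k s t) (auto simp: lt_def le_def)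

lemma wf_eq: "\<Delta> \<turnstile> s \<triangleright> \<tau> \<Longrightarrow> \<Delta> \<turnstile> t \<triangleright> \<tau> \<Longrightarrow> wf_fm \<Delta> (eq \<tau> s t)"
proof (induction \<tau> arbitrary: \<Delta> s t)
  case (Fun \<sigma> \<tau>)
  then show ?case by (auto intro!: Fun.IH(2) exI[of _ \<sigma>] has_ty_lift)
next
  case (Seq \<sigma>)
  then show ?case by (auto intro!: Seq.IH has_ty_lift simp: lt_def le_def)
qed auto

locale epra_model =
  fixes T :: "fm set" and Q :: "tm \<Rightarrow> tm \<Rightarrow> bool" and S :: "tm \<Rightarrow> bool"
  assumes EPRA_subset: "EPRA \<subseteq> T"
    and sound: "T \<tturnstile> \<phi> \<Longrightarrow> formula \<phi> \<Longrightarrow> sat Q S \<phi>"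
begin

text \<open>The parameters of an axiom are generalised in the calculus; evaluating the quantifiers
  then yields its instances for arbitrary terms of the right types.\<close>

lemma sat_closure:
  assumes "\<phi> \<in> T" "formula \<phi>"
  shows "sat Q S (foldr all_v xs \<phi>)"
proof -
  have "T \<tturnstile> foldr all_v xs \<phi> \<and> formula (foldr all_v xs \<phi>)"
    using assms by (induction xs) (auto simp: proves_def proves_all_v[unfolded proves_def] intro: deriv.Ax)
  then show ?thesis using sound by blast
qed

lemmas EPRA_closure = sat_closure[OF subsetD[OF EPRA_subset]]

section \<open>Equality at all types as a congruence\<close>

lemma Q_refl: "term_of_ty t N \<Longrightarrow> Q t t"
  using EPRA_closure[OF EPRA.eq_refl, of "[(0, N)]"] by (simp add: all_v_def)

lemma Q_sym: "term_of_ty s N \<Longrightarrow> term_of_ty t N \<Longrightarrow> Q s t \<Longrightarrow> Q t s"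
  using EPRA_closure[OF EPRA.eq_sym, of "[(0, N), (1, N)]", simplified, unfolded all_v_def, simplified]
  by blast

lemma Q_trans:
  "term_of_ty r N \<Longrightarrow> term_of_ty s N \<Longrightarrow> term_of_ty t N \<Longrightarrow> Q r s \<Longrightarrow> Q s t \<Longrightarrow> Q r t"
  using EPRA_closure[OF EPRA.eq_trans, of "[(0, N), (1, N), (2, N)]",
      simplified, unfolded all_v_def, simplified]
  by blast

lemma sat_ext:
  assumes "term_of_ty a \<rho>" "term_of_ty b \<rho>" "term_of_ty f (\<rho> \<rightarrow> \<tau>)" "sat Q S (eq \<rho> a b)"
  shows "sat Q S (eq \<tau> (f \<cdot> a) (f \<cdot> b))"
  using EPRA_closure[OF EPRA.ext[of \<rho> \<tau>], of "[(0, \<rho>), (1, \<rho>), (2, \<rho> \<rightarrow> \<tau>)]"] assms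
  by (simp add: all_v_def wf_eq)

lemma sat_eq_Fun:
  assumes "term_of_ty s (\<sigma> \<rightarrow> \<tau>)" "term_of_ty t (\<sigma> \<rightarrow> \<tau>)"
  shows "sat Q S (eq (\<sigma> \<rightarrow> \<tau>) s t) \<longleftrightarrow> (\<forall>u. term_of_ty u \<sigma> \<longrightarrow> sat Q S (eq \<tau> (s \<cdot> u) (t \<cdot> u)))"
  using assms by simp

lemma sat_eq_Seq:
  assumes "term_of_ty s (Seq \<sigma>)" "term_of_ty t (Seq \<sigma>)"
  shows "sat Q S (eq (Seq \<sigma>) s t) \<longleftrightarrow> Q (Cn (LenC \<sigma>) \<cdot> s) (Cn (LenC \<sigma>) \<cdot> t) \<and>
    (\<forall>i. term_of_ty i N \<longrightarrow> Q (monus (succ i) (Cn (LenC \<sigma>) \<cdot> s)) zero \<longrightarrow>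
      sat Q S (eq \<sigma> (Cn (AtC \<sigma>) \<cdot> s \<cdot> i) (Cn (AtC \<sigma>) \<cdot> t \<cdot> i)))"
  using assms by (simp add: lt_def le_def)

text \<open>Replaces the length that bounds a position, before congruence is available in general.
  The second argument of \<open>monus\<close> is the recursion argument, so the axiom
  \<open>ext\<close> for the constant \<open>RecC\<close> suffices, followed by pointwise
  evaluation.\<close>

lemma Q_monus_cong:
  assumes "term_of_ty r N" "term_of_ty s N" "term_of_ty t N" "Q s t" "Q (monus r s) zero"
  shows "Q (monus r t) zero"
proof -
  note [simp] = has_ty_closed_iff[OF assms(1)] has_ty_closed_iff[OF assms(2)]
    has_ty_closed_iff[OF assms(3)]
  have "Q t s" using assms Q_sym by blast
  then have "sat Q S (eq (N \<rightarrow> (N \<rightarrow> N \<rightarrow> N) \<rightarrow> N) (Cn RecC \<cdot> t) (Cn RecC \<cdot> s))"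
    by (intro sat_ext[of _ N]) auto
  then have "Q (monus r t) (monus r s)" by (simp add: monus_def)
  then show ?thesis using Q_trans assms(5) by (metis (full_types) assms(1-3) has_ty_Cn has_ty_monus cn_ty.simps(1))
qed

lemma sat_eq_refl: "term_of_ty t \<tau> \<Longrightarrow> sat Q S (eq \<tau> t t)"
proof (induction \<tau> arbitrary: t)
  case (Fun \<sigma> \<tau>)
  then have "sat Q S (eq \<tau> (t \<cdot> u) (t \<cdot> u))" if "term_of_ty u \<sigma>" for u
    using that ty_App by blast
  with Fun.prems show ?case using sat_eq_Fun by blast
next
  case (Seq \<sigma>)
  then show ?case by (subst sat_eq_Seq) (auto simp del: eq.simps intro: Q_refl)
qed (simp add: Q_refl)

text \<open>Only type 0 has equality axioms; the rest follows by induction on the type. For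
  sequences, the clause bounds positions by the length of the left-hand sequence, and this bound
  must be exchanged.\<close>

lemma sat_eq_sym:
  "term_of_ty s \<tau> \<Longrightarrow> term_of_ty t \<tau> \<Longrightarrow> sat Q S (eq \<tau> s t) \<Longrightarrow> sat Q S (eq \<tau> t s)"
proof (induction \<tau> arbitrary: s t)
  case N
  then show ?case using Q_sym[of s t] by simp
next
  case (Fun \<sigma> \<tau>)
  then have *: "sat Q S (eq \<tau> (s \<cdot> u) (t \<cdot> u))" if "term_of_ty u \<sigma>" for u
    using sat_eq_Fun that by blast
  have "sat Q S (eq \<tau> (t \<cdot> u) (s \<cdot> u))" if "term_of_ty u \<sigma>" for u
    by (rule Fun.IH(2)) (use Fun.prems that * in \<open>auto simp del: eq.simps\<close>)
  then show ?case using Fun.prems sat_eq_Fun by blast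
next
  case (Seq \<sigma>)
  let ?l = "Cn (LenC \<sigma>)" and ?a = "Cn (AtC \<sigma>)"
  have l: "term_of_ty (?l \<cdot> s) N" "term_of_ty (?l \<cdot> t) N" using Seq.prems by simp_all
  have 1: "Q (?l \<cdot> t) (?l \<cdot> s)" using Seq.prems l sat_eq_Seq Q_sym by blast
  have "sat Q S (eq \<sigma> (?a \<cdot> t \<cdot> i) (?a \<cdot> s \<cdot> i))"
    if i: "term_of_ty i N" "Q (monus (succ i) (?l \<cdot> t)) zero" for i
  proof (rule Seq.IH)
    have "term_of_ty (succ i) N" using i by simp
    then have "Q (monus (succ i) (?l \<cdot> s)) zero" using Q_monus_cong l 1 i(2) by blast
    then show "sat Q S (eq \<sigma> (?a \<cdot> s \<cdot> i) (?a \<cdot> t \<cdot> i))"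
      using Seq.prems i(1) sat_eq_Seq by blast
  qed (use Seq.prems i in simp_all)
  with 1 show ?case using Seq.prems sat_eq_Seq by blast
qed

lemma sat_eq_trans:
  "term_of_ty r \<tau> \<Longrightarrow> term_of_ty s \<tau> \<Longrightarrow> term_of_ty t \<tau> \<Longrightarrow>
    sat Q S (eq \<tau> r s) \<Longrightarrow> sat Q S (eq \<tau> s t) \<Longrightarrow> sat Q S (eq \<tau> r t)"
proof (induction \<tau> arbitrary: r s t)
  case N
  then show ?case using Q_trans[of r s t] by simp
next
  case (Fun \<sigma> \<tau>)
  then have *: "sat Q S (eq \<tau> (r \<cdot> u) (s \<cdot> u))" "sat Q S (eq \<tau> (s \<cdot> u) (t \<cdot> u))"
    if "term_of_ty u \<sigma>" for u
    using sat_eq_Fun that by blast+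
  have "sat Q S (eq \<tau> (r \<cdot> u) (t \<cdot> u))" if "term_of_ty u \<sigma>" for u
    by (rule Fun.IH(2)[OF _ _ _ *[OF that]]) (use Fun.prems that in auto)
  then show ?case using Fun.prems sat_eq_Fun by blast
next
  case (Seq \<sigma>)
  let ?l = "Cn (LenC \<sigma>)" and ?a = "Cn (AtC \<sigma>)"
  have l: "term_of_ty (?l \<cdot> r) N" "term_of_ty (?l \<cdot> s) N" "term_of_ty (?l \<cdot> t) N"
    using Seq.prems by simp_all
  have 1: "Q (?l \<cdot> r) (?l \<cdot> s)" "Q (?l \<cdot> s) (?l \<cdot> t)" using Seq.prems sat_eq_Seq by blast+
  have "sat Q S (eq \<sigma> (?a \<cdot> r \<cdot> i) (?a \<cdot> t \<cdot> i))"
    if i: "term_of_ty i N" "Q (monus (succ i) (?l \<cdot> r)) zero" for i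
  proof (rule Seq.IH)
    show "sat Q S (eq \<sigma> (?a \<cdot> r \<cdot> i) (?a \<cdot> s \<cdot> i))"
      using Seq.prems i sat_eq_Seq by blast
    have "term_of_ty (succ i) N" using i by simp
    then have "Q (monus (succ i) (?l \<cdot> s)) zero" using Q_monus_cong l 1 i(2) by blast
    then show "sat Q S (eq \<sigma> (?a \<cdot> s \<cdot> i) (?a \<cdot> t \<cdot> i))"
      using Seq.prems i(1) sat_eq_Seq by blast
  qed (use Seq.prems i in simp_all)
  moreover have "Q (?l \<cdot> r) (?l \<cdot> t)" using Q_trans l 1 by blast
  ultimately show ?case using Seq.prems sat_eq_Seq by blast
qed

text \<open>Carrying the types of both sides lets equations be chained without repeated typing
  arguments.\<close>

definition rel :: "ty \<Rightarrow> tm \<Rightarrow> tm \<Rightarrow> bool" where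
  "rel \<tau> s t \<longleftrightarrow> term_of_ty s \<tau> \<and> term_of_ty t \<tau> \<and> sat Q S (eq \<tau> s t)"

lemma relD: "rel \<tau> s t \<Longrightarrow> term_of_ty s \<tau>" "rel \<tau> s t \<Longrightarrow> term_of_ty t \<tau>"
  by (auto simp: rel_def)

lemma rel_N: "rel N s t \<longleftrightarrow> term_of_ty s N \<and> term_of_ty t N \<and> Q s t"
  by (simp add: rel_def)

lemma rel_refl: "term_of_ty t \<tau> \<Longrightarrow> rel \<tau> t t"
  by (simp add: rel_def sat_eq_refl)

lemma rel_sym: "rel \<tau> s t \<Longrightarrow> rel \<tau> t s"
  unfolding rel_def using sat_eq_sym by blast

lemma rel_trans [trans]: "rel \<tau> r s \<Longrightarrow> rel \<tau> s t \<Longrightarrow> rel \<tau> r t"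
  unfolding rel_def using sat_eq_trans by blast

text \<open>The axiom \<open>ext\<close> replaces the argument; the pointwise definition of equality
  replaces the function.\<close>

lemma rel_app:
  assumes f: "rel (\<sigma> \<rightarrow> \<tau>) f g" and a: "rel \<sigma> a b"
  shows "rel \<tau> (f \<cdot> a) (g \<cdot> b)"
proof (rule rel_trans)
  note ty = relD[OF f] relD[OF a]
  have app: "term_of_ty (f \<cdot> a) \<tau>" "term_of_ty (f \<cdot> b) \<tau>" "term_of_ty (g \<cdot> b) \<tau>"
    using ty ty_App by blast+
  have "sat Q S (eq \<sigma> a b)" using a by (simp only: rel_def)
  with sat_ext ty have "sat Q S (eq \<tau> (f \<cdot> a) (f \<cdot> b))" by blast
  with app show "rel \<tau> (f \<cdot> a) (f \<cdot> b)" by (simp only: rel_def)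
  have "sat Q S (eq (\<sigma> \<rightarrow> \<tau>) f g)" using f by (simp only: rel_def)
  with sat_eq_Fun ty have "sat Q S (eq \<tau> (f \<cdot> b) (g \<cdot> b))" by blast
  with app show "rel \<tau> (f \<cdot> b) (g \<cdot> b)" by (simp only: rel_def)
qed

lemmas rel_app1 = rel_app[OF _ rel_refl]
lemmas rel_app2 = rel_app[OF rel_refl]

lemma rel_Pi:
  assumes "term_of_ty a \<rho>" "term_of_ty b \<tau>"
  shows "rel \<rho> (Cn (PiC \<rho> \<tau>) \<cdot> a \<cdot> b) a"
  using EPRA_closure[OF EPRA.Pi_ax[of \<rho> \<tau>], of "[(0, \<rho>), (1, \<tau>)]"] assms
  by (simp add: all_v_def wf_eq rel_def)

lemma rel_Sigma:
  assumes "term_of_ty a (\<delta> \<rightarrow> \<rho> \<rightarrow> \<tau>)" "term_of_ty b (\<delta> \<rightarrow> \<rho>)" "term_of_ty c \<delta>"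
  shows "rel \<tau> (Cn (SigmaC \<delta> \<rho> \<tau>) \<cdot> a \<cdot> b \<cdot> c) (a \<cdot> c \<cdot> (b \<cdot> c))"
  using EPRA_closure[OF EPRA.Sigma_ax[of \<tau> \<delta> \<rho>], of "[(0, \<delta> \<rightarrow> \<rho> \<rightarrow> \<tau>), (1, \<delta> \<rightarrow> \<rho>), (2, \<delta>)]"] assms
    has_ty_closed_iff[OF assms(1)] has_ty_closed_iff[OF assms(2)] has_ty_closed_iff[OF assms(3)]
  by (simp add: all_v_def wf_eq rel_def)

lemma rel_rec_zero:
  assumes "term_of_ty y N" "term_of_ty h (N \<rightarrow> N \<rightarrow> N)"
  shows "rel N (rec0 zero y h) y"
  using EPRA_closure[OF EPRA.rec_zero, of "[(0, N), (1, N \<rightarrow> N \<rightarrow> N)]"] assms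
  by (simp add: all_v_def rel_def)

lemma rel_rec_succ:
  assumes "term_of_ty n N" "term_of_ty y N" "term_of_ty h (N \<rightarrow> N \<rightarrow> N)"
  shows "rel N (rec0 (succ n) y h) (h \<cdot> rec0 n y h \<cdot> n)"
  using EPRA_closure[OF EPRA.rec_succ, of "[(0, N), (1, N \<rightarrow> N \<rightarrow> N), (2, N)]"] assms
    has_ty_closed_iff[OF assms(3)]
  by (simp add: all_v_def rel_def)

lemma rel_rec_cong:
  assumes "rel N n m" "term_of_ty y N" "term_of_ty h (N \<rightarrow> N \<rightarrow> N)"
  shows "rel N (rec0 n y h) (rec0 m y h)"
proof -
  have "rel (N \<rightarrow> (N \<rightarrow> N \<rightarrow> N) \<rightarrow> N) (Cn RecC \<cdot> n) (Cn RecC \<cdot> m)"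
    by (rule rel_app2[OF _ assms(1)]) simp
  then show ?thesis using assms rel_app1 by blast
qed

lemma rel_succ_cong: "rel N s t \<Longrightarrow> rel N (succ s) (succ t)"
  by (rule rel_app2) auto

lemma not_rel_succ_zero: "\<not> rel N (succ t) zero"
  using EPRA_closure[OF EPRA.succ_not_zero, of "[(0, N)]"]
  by (auto simp: all_v_def rel_def)

lemma rel_succ_inj: "rel N (succ s) (succ t) \<Longrightarrow> rel N s t"
  using EPRA_closure[OF EPRA.succ_inj, of "[(0, N), (1, N)]",
      simplified, unfolded all_v_def, simplified]
  unfolding rel_N has_ty_App has_ty_Cn cn_ty.simps ty.inject by blast

section \<open>Quantifier-free induction over terms\<close>

lemma opn_tm_cls_opn:
  "x \<notin> fv_tm s \<Longrightarrow> opn_tm 0 t (cls_tm 0 x (opn_tm 0 u s)) = opn_tm 0 (opn_tm 0 t (cls_tm 0 x u)) s"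
  by (induction s) auto

text \<open>Without quantifiers the index 0 never shifts, so opening, closing and reopening reduces
  to its effect on terms.\<close>

lemma opn_cls_opn_qf:
  "qf \<phi> \<Longrightarrow> x \<notin> fv \<phi> \<Longrightarrow> opn 0 t (cls 0 x (opn 0 u \<phi>)) = opn 0 (opn_tm 0 t (cls_tm 0 x u)) \<phi>"
  by (induction \<phi>) (auto simp: opn_tm_cls_opn)

lemma qf_opn: "qf \<phi> \<Longrightarrow> qf (opn k u \<phi>)"
  by (induction \<phi>) auto

text \<open>The index 0 of \<phi> is the induction variable, and arbitrary terms may occur as
  parameters. The conclusion reaches every term of type 0, also those for nonstandard numbers, which
  an induction over numerals would miss.\<close>

lemma qf_induct:
  assumes \<phi>: "wf_fm [N] \<phi>" "qf \<phi>"
    and base: "sat Q S (opn 0 zero \<phi>)"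
    and step: "\<And>t. term_of_ty t N \<Longrightarrow> sat Q S (opn 0 t \<phi>) \<Longrightarrow> sat Q S (opn 0 (succ t) \<phi>)"
    and t: "term_of_ty t N"
  shows "sat Q S (opn 0 t \<phi>)"
proof -
  obtain n where n: "(n, N) \<notin> fv \<phi>" using fresh_var[of "fv \<phi>"] by auto
  let ?x = "(n, N)"
  let ?\<psi> = "opn 0 (Fv ?x) \<phi>"
  have \<psi>: "formula ?\<psi>" "qf ?\<psi>" using \<phi> by (auto intro: formula_opn qf_opn)
  have subst: "subst ?x u ?\<psi> = opn 0 u \<phi>" for u
    unfolding subst_def using opn_cls_opn_qf[OF \<phi>(2) n] by simp
  let ?A = "subst ?x zero ?\<psi> \<^bold>\<and> (\<^bold>\<forall>?x. (?\<psi> \<^bold>\<longrightarrow> subst ?x (succ (Fv ?x)) ?\<psi>)) \<^bold>\<longrightarrow> (\<^bold>\<forall>?x. ?\<psi>)"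
  have "formula (subst ?x zero ?\<psi>)" "formula (subst ?x (succ (Fv ?x)) ?\<psi>)"
    unfolding subst using \<phi>(1) by (auto intro: formula_opn)
  then have "formula ?A" using \<psi> by (auto intro!: formula_all_v)
  then have "sat Q S ?A" using EPRA_closure[OF EPRA.qf_ind[OF \<psi>], of ?x "[]"] by simp
  moreover have "sat Q S (subst ?x zero ?\<psi>)" using base subst by simp
  moreover have "sat Q S (\<^bold>\<forall>?x. (?\<psi> \<^bold>\<longrightarrow> subst ?x (succ (Fv ?x)) ?\<psi>))"
    unfolding subst using step opn_cls_opn_qf[OF \<phi>(2) n] by (simp add: all_v_def)
  ultimately have "sat Q S (\<^bold>\<forall>?x. ?\<psi>)" unfolding sat.simps by blast
  then show ?thesis using t opn_cls_opn_qf[OF \<phi>(2) n] by (simp add: all_v_def)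
qed

end

section \<open>Abstraction by combinators\<close>

text \<open>Abstraction has to choose the type indices of \<Pi> and \<Sigma>, which a raw term does
  not display. The value \<open>N\<close> for indices and ill-typed applications is
  arbitrary.\<close>

primrec ty_of :: "tm \<Rightarrow> ty" where
  "ty_of (Fv x) = snd x"
| "ty_of (Bv i) = N"
| "ty_of (Cn c) = cn_ty c"
| "ty_of (s \<cdot> t) = (case ty_of s of \<sigma> \<rightarrow> \<tau> \<Rightarrow> \<tau> | _ \<Rightarrow> N)"

lemma ty_of_eq: "term_of_ty t \<sigma> \<Longrightarrow> ty_of t = \<sigma>"
  by (induction t arbitrary: \<sigma>) fastforce+

text \<open>Bracket abstraction with \<Sigma>\<Pi>\<Pi> as identity. \<Sigma> is used at every
  application, even where \<open>x\<close> does not occur, which keeps the proof of the \<beta>-law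
  a plain induction. The clause for \<open>Bv\<close> is a dummy: only terms without loose indices
  are abstracted.\<close>

primrec lam :: "var \<Rightarrow> tm \<Rightarrow> tm" where
  "lam x (Fv y) = (if y = x
    then Cn (SigmaC (snd x) (snd x \<rightarrow> snd x) (snd x)) \<cdot> Cn (PiC (snd x) (snd x \<rightarrow> snd x))
      \<cdot> Cn (PiC (snd x) (snd x))
    else Cn (PiC (snd y) (snd x)) \<cdot> Fv y)"
| "lam x (Bv i) = Bv i"
| "lam x (Cn c) = Cn (PiC (cn_ty c) (snd x)) \<cdot> Cn c"
| "lam x (s \<cdot> t) = Cn (SigmaC (snd x) (ty_of t) (ty_of (s \<cdot> t))) \<cdot> lam x s \<cdot> lam x t"

text \<open>Simultaneous substitution acts as an environment that each applied abstraction merely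
  updates; substitutions need not be composed.\<close>

primrec msub :: "(var \<Rightarrow> tm) \<Rightarrow> tm \<Rightarrow> tm" where
  "msub \<theta> (Fv x) = \<theta> x"
| "msub \<theta> (Bv i) = Bv i"
| "msub \<theta> (Cn c) = Cn c"
| "msub \<theta> (s \<cdot> t) = msub \<theta> s \<cdot> msub \<theta> t"

lemma msub_Fv [simp]: "msub Fv t = t"
  by (induction t) auto

lemma msub_closed: "fv_tm t = {} \<Longrightarrow> msub \<theta> t = t"
  by (induction t) auto

lemma fv_lam: "fv_tm (lam x t) = fv_tm t - {x}"
  by (induction t) auto

lemma has_ty_lam: "term_of_ty t \<tau> \<Longrightarrow> term_of_ty (lam x t) (snd x \<rightarrow> \<tau>)"
  by (induction t arbitrary: \<tau>) (fastforce simp: ty_of_eq)+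

lemma has_ty_lam_pair: "term_of_ty t \<tau> \<Longrightarrow> term_of_ty (lam (n, \<sigma>) t) (\<sigma> \<rightarrow> \<tau>)"
  using has_ty_lam[of t \<tau> "(n, \<sigma>)"] by simp

lemma has_ty_msub:
  "\<forall>y. term_of_ty (\<theta> y) (snd y) \<Longrightarrow> term_of_ty t \<tau> \<Longrightarrow> term_of_ty (msub \<theta> t) \<tau>"
  by (induction t arbitrary: \<tau>) fastforce+

text \<open>\<open>const2 r\<close> is \<open>\<lambda>a b. r\<close>, so that \<open>rec0 n y (const2 r)\<close> distinguishes the cases
  \<open>n = 0\<close> (value \<open>y\<close>) and \<open>n \<noteq> 0\<close> (value \<open>r\<close>).\<close>

definition const2 :: "tm \<Rightarrow> tm" where
  "const2 r = Cn (PiC (N \<rightarrow> N) N) \<cdot> (Cn (PiC N N) \<cdot> r)"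

lemma has_ty_const2 [simp]: "\<Delta> \<turnstile> const2 r \<triangleright> \<tau> \<longleftrightarrow> \<tau> = N \<rightarrow> N \<rightarrow> N \<and> \<Delta> \<turnstile> r \<triangleright> N"
  by (auto simp: const2_def)

lemma msub_const2 [simp]: "msub \<theta> (const2 t) = const2 (msub \<theta> t)"
  by (simp add: const2_def)

lemma fv_const2 [simp]: "fv_tm (const2 t) = fv_tm t"
  by (simp add: const2_def)

text \<open>\<open>step_fun X\<close> is \<open>\<lambda>r i. X r\<close>; it occurs in the definition of \<open>monus\<close>.\<close>

definition step_fun :: "tm \<Rightarrow> tm" where
  "step_fun X = Cn (SigmaC N N (N \<rightarrow> N)) \<cdot> (Cn (PiC (N \<rightarrow> N \<rightarrow> N) N) \<cdot> Cn (PiC N N)) \<cdot> X"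

lemma has_ty_step_fun [simp]: "\<Delta> \<turnstile> step_fun X \<triangleright> \<tau> \<longleftrightarrow> \<tau> = N \<rightarrow> N \<rightarrow> N \<and> \<Delta> \<turnstile> X \<triangleright> N \<rightarrow> N"
  by (auto simp: step_fun_def)

lemma monus_rec: "monus s t = rec0 t s (step_fun pred_fun)"
  by (simp add: monus_def step_fun_def)

text \<open>Addition is needed to recover a number from a truncated difference, since
  \<open>monus\<close> alone does not show that a difference of 1 determines its arguments from each
  other.\<close>

definition nplus :: "tm \<Rightarrow> tm \<Rightarrow> tm" where
  "nplus s t = rec0 t s (step_fun (Cn Succ))"

lemma has_ty_nplus [simp]: "\<Delta> \<turnstile> nplus s t \<triangleright> \<tau> \<longleftrightarrow> \<tau> = N \<and> \<Delta> \<turnstile> s \<triangleright> N \<and> \<Delta> \<turnstile> t \<triangleright> N"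
  by (auto simp: nplus_def)

lemma opn_tm_nplus [simp]: "opn_tm k u (nplus s t) = nplus (opn_tm k u s) (opn_tm k u t)"
  by (simp add: nplus_def step_fun_def)

context epra_model
begin

text \<open>At an application the \<Sigma> axiom distributes the argument, and congruence combines
  the two induction hypotheses; hence the law holds up to \<open>rel\<close> only.\<close>

lemma lam_beta:
  assumes \<theta>: "\<forall>y. term_of_ty (\<theta> y) (snd y)" and u: "term_of_ty u (snd x)"
  shows "term_of_ty t \<tau> \<Longrightarrow> rel \<tau> (msub \<theta> (lam x t) \<cdot> u) (msub (\<theta>(x := u)) t)"
proof (induction t arbitrary: \<tau>)
  case (Fv y)
  show ?case
  proof (cases "y = x")
    case True
    let ?\<sigma> = "snd x"
    have "rel ?\<sigma> (msub \<theta> (lam x (Fv x)) \<cdot> u)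
      (Cn (PiC ?\<sigma> (?\<sigma> \<rightarrow> ?\<sigma>)) \<cdot> u \<cdot> (Cn (PiC ?\<sigma> ?\<sigma>) \<cdot> u))"
      using rel_Sigma[of _ ?\<sigma> "?\<sigma> \<rightarrow> ?\<sigma>" ?\<sigma>] u by simp
    also have "rel ?\<sigma> \<dots> u" using u by (intro rel_Pi) auto
    finally show ?thesis using Fv True by simp
  next
    case False
    have "rel (snd y) (Cn (PiC (snd y) (snd x)) \<cdot> \<theta> y \<cdot> u) (\<theta> y)"
      using rel_Pi[OF \<theta>[rule_format] u] .
    then show ?thesis using Fv False by simp
  qed
next
  case (Cn c)
  then show ?case using rel_Pi[of "Cn c" "cn_ty c" u "snd x"] u by simp
next
  case (App s t)
  then obtain \<sigma> where \<sigma>: "term_of_ty s (\<sigma> \<rightarrow> \<tau>)" "term_of_ty t \<sigma>" by auto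
  have ty: "term_of_ty (msub \<theta> (lam x s)) (snd x \<rightarrow> \<sigma> \<rightarrow> \<tau>)"
    "term_of_ty (msub \<theta> (lam x t)) (snd x \<rightarrow> \<sigma>)"
    using \<sigma> \<theta> by (auto intro: has_ty_msub has_ty_lam)
  have "rel \<tau> (msub \<theta> (lam x (s \<cdot> t)) \<cdot> u)
      (msub \<theta> (lam x s) \<cdot> u \<cdot> (msub \<theta> (lam x t) \<cdot> u))"
    using rel_Sigma[OF ty u] \<sigma> by (simp add: ty_of_eq)
  also have "rel \<tau> \<dots> (msub (\<theta>(x := u)) (s \<cdot> t))"
    unfolding msub.simps by (rule rel_app[OF App.IH(1)[OF \<sigma>(1)] App.IH(2)[OF \<sigma>(2)]])
  finally show ?case .
qed simp

lemma rel_msub_Fv: "term_of_ty F \<tau> \<Longrightarrow> rel \<tau> F (msub Fv F)"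
  by (simp add: rel_refl)

text \<open>Iterating this rule, starting from \<open>rel_msub_Fv\<close>, evaluates nested abstractions.\<close>

lemma lam_app:
  assumes "rel (\<sigma> \<rightarrow> \<tau>) F (msub \<theta> (lam (n, \<sigma>) t))" "\<forall>y. term_of_ty (\<theta> y) (snd y)"
    "term_of_ty u \<sigma>" "term_of_ty t \<tau>"
  shows "rel \<tau> (F \<cdot> u) (msub (\<theta>((n, \<sigma>) := u)) t)"
  using rel_trans[OF rel_app1[OF assms(1,3)] lam_beta[OF assms(2) _ assms(4), of u "(n, \<sigma>)"]] assms(3)
  by simp

section \<open>Case distinction, predecessor, subtraction and addition\<close>

lemma rel_id: "term_of_ty a N \<Longrightarrow> rel N (id_fun \<cdot> a) a"
  \<comment> \<open>\<open>id_fun\<close> is literally the term that \<open>lam\<close> produces for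
    the identity on type 0.\<close>
  using lam_beta[of Fv a "(0, N)" "v 0 N" N] by (simp add: id_fun_def)

lemma rel_const2:
  assumes "term_of_ty r N" "term_of_ty a N" "term_of_ty b N"
  shows "rel N (const2 r \<cdot> a \<cdot> b) r"
proof -
  have "rel (N \<rightarrow> N) (const2 r \<cdot> a) (Cn (PiC N N) \<cdot> r)"
    unfolding const2_def by (rule rel_Pi) (use assms in auto)
  then have "rel N (const2 r \<cdot> a \<cdot> b) (Cn (PiC N N) \<cdot> r \<cdot> b)" by (rule rel_app1) fact
  also have "rel N \<dots> r" by (rule rel_Pi) fact+
  finally show ?thesis .
qed

lemma rel_case_zero:
  assumes "rel N n zero" "term_of_ty y N" "term_of_ty r N"
  shows "rel N (rec0 n y (const2 r)) y"
proof -
  have h: "term_of_ty (const2 r) (N \<rightarrow> N \<rightarrow> N)" using assms by simp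
  show ?thesis using rel_trans[OF rel_rec_cong[OF assms(1,2) h] rel_rec_zero[OF assms(2) h]] .
qed

lemma rel_case_succ:
  assumes "rel N n (succ m)" "term_of_ty y N" "term_of_ty r N"
  shows "rel N (rec0 n y (const2 r)) r"
proof -
  have m: "term_of_ty m N" using relD(2)[OF assms(1)] by simp
  have h: "term_of_ty (const2 r) (N \<rightarrow> N \<rightarrow> N)" using assms by simp
  have "rel N (rec0 n y (const2 r)) (rec0 (succ m) y (const2 r))"
    using rel_rec_cong[OF assms(1,2) h] .
  also have "rel N \<dots> (const2 r \<cdot> rec0 m y (const2 r) \<cdot> m)"
    using rel_rec_succ[OF m assms(2) h] .
  also have "rel N \<dots> r" by (rule rel_const2) (use assms m in simp_all)
  finally show ?thesis .
qed

lemma rel_pred_fun: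
  assumes a: "term_of_ty a N"
  shows "rel N (pred_fun \<cdot> a) (rec0 a zero (Cn (PiC (N \<rightarrow> N) N) \<cdot> id_fun))"
proof -
  let ?A = "Cn (SigmaC N N ((N \<rightarrow> N \<rightarrow> N) \<rightarrow> N)) \<cdot> Cn RecC \<cdot> (Cn (PiC N N) \<cdot> zero)"
  let ?C = "Cn (PiC (N \<rightarrow> N) N) \<cdot> id_fun"
  let ?B = "Cn (PiC (N \<rightarrow> N \<rightarrow> N) N) \<cdot> ?C"
  have "rel N (pred_fun \<cdot> a) (?A \<cdot> a \<cdot> (?B \<cdot> a))"
    unfolding pred_fun_def by (rule rel_Sigma) (use a in auto)
  also have "rel N \<dots> (rec0 a zero ?C)"
  proof (rule rel_app)
    show "rel (N \<rightarrow> N \<rightarrow> N) (?B \<cdot> a) ?C" by (rule rel_Pi) (use a in auto)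
    have "rel ((N \<rightarrow> N \<rightarrow> N) \<rightarrow> N) (?A \<cdot> a) (Cn RecC \<cdot> a \<cdot> (Cn (PiC N N) \<cdot> zero \<cdot> a))"
      by (rule rel_Sigma) (use a in auto)
    also have "rel ((N \<rightarrow> N \<rightarrow> N) \<rightarrow> N) \<dots> (Cn RecC \<cdot> a \<cdot> zero)"
      by (rule rel_app2[OF _ rel_Pi]) (use a in auto)
    finally show "rel ((N \<rightarrow> N \<rightarrow> N) \<rightarrow> N) (?A \<cdot> a) (Cn RecC \<cdot> a \<cdot> zero)" .
  qed
  finally show ?thesis .
qed

lemma rel_pred_zero: "rel N (pred_fun \<cdot> zero) zero"
  by (rule rel_trans[OF rel_pred_fun rel_rec_zero]) auto

lemma rel_pred_succ:
  assumes a: "term_of_ty a N"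
  shows "rel N (pred_fun \<cdot> succ a) a"
proof -
  let ?C = "Cn (PiC (N \<rightarrow> N) N) \<cdot> id_fun"
  have "rel N (pred_fun \<cdot> succ a) (rec0 (succ a) zero ?C)"
    by (rule rel_pred_fun) (use a in auto)
  also have "rel N \<dots> (?C \<cdot> rec0 a zero ?C \<cdot> a)" by (rule rel_rec_succ) (use a in auto)
  also have "rel N \<dots> (id_fun \<cdot> a)" by (rule rel_app1[OF rel_Pi]) (use a in auto)
  also have "rel N \<dots> a" by (rule rel_id) fact
  finally show ?thesis .
qed

lemma rel_step_fun:
  assumes X: "term_of_ty X (N \<rightarrow> N)" and r: "term_of_ty r N" and i: "term_of_ty i N"
  shows "rel N (step_fun X \<cdot> r \<cdot> i) (X \<cdot> r)"
proof -
  note [simp] = has_ty_closed_iff[OF X]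
  let ?P = "Cn (PiC (N \<rightarrow> N \<rightarrow> N) N) \<cdot> Cn (PiC N N)"
  have "rel (N \<rightarrow> N) (step_fun X \<cdot> r) (?P \<cdot> r \<cdot> (X \<cdot> r))"
    unfolding step_fun_def by (rule rel_Sigma) (use r in auto)
  also have "rel (N \<rightarrow> N) \<dots> (Cn (PiC N N) \<cdot> (X \<cdot> r))"
    by (rule rel_app1[OF rel_Pi]) (use r in auto)
  finally have "rel N (step_fun X \<cdot> r \<cdot> i) (Cn (PiC N N) \<cdot> (X \<cdot> r) \<cdot> i)"
    by (rule rel_app1) fact
  also have "rel N \<dots> (X \<cdot> r)" by (rule rel_Pi) (use r i in auto)
  finally show ?thesis .
qed

lemma rel_monus_zero: "term_of_ty s N \<Longrightarrow> rel N (monus s zero) s"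
  unfolding monus_rec by (rule rel_rec_zero) auto

lemma rel_monus_succ:
  assumes "term_of_ty s N" "term_of_ty t N"
  shows "rel N (monus s (succ t)) (pred_fun \<cdot> monus s t)"
  unfolding monus_rec
  by (rule rel_trans[OF rel_rec_succ rel_step_fun]) (use assms in auto)

lemma rel_pred_cong: "rel N s t \<Longrightarrow> rel N (pred_fun \<cdot> s) (pred_fun \<cdot> t)"
  by (rule rel_app2) auto

text \<open>Naming the predecessor by a term instead of an existential quantifier keeps the
  statement within quantifier-free induction.\<close>

lemma zero_or_succ:
  assumes "term_of_ty n N"
  shows "rel N n zero \<or> rel N n (succ (pred_fun \<cdot> n))"
proof -
  let ?\<phi> = "Bv 0 \<^bold>= zero \<^bold>\<or> Bv 0 \<^bold>= succ (pred_fun \<cdot> Bv 0)"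
  have "sat Q S (opn 0 n ?\<phi>)"
  proof (rule qf_induct)
    fix t assume t: "term_of_ty t N"
    have "rel N (succ t) (succ (pred_fun \<cdot> succ t))"
      using rel_succ_cong[OF rel_sym[OF rel_pred_succ[OF t]]] .
    then show "sat Q S (opn 0 (succ t) ?\<phi>)" by (simp add: rel_N)
  qed (use assms in \<open>auto intro: Q_refl\<close>)
  then show ?thesis using assms by (simp add: rel_N)
qed

lemma rel_nplus_zero: "term_of_ty s N \<Longrightarrow> rel N (nplus s zero) s"
  unfolding nplus_def by (rule rel_rec_zero) auto

lemma rel_nplus_succ:
  assumes "term_of_ty s N" "term_of_ty t N"
  shows "rel N (nplus s (succ t)) (succ (nplus s t))"
  unfolding nplus_def
  by (rule rel_trans[OF rel_rec_succ rel_step_fun]) (use assms in auto)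

lemma rel_nplus_cong: "rel N s s' \<Longrightarrow> term_of_ty t N \<Longrightarrow> rel N (nplus s t) (nplus s' t)"
  unfolding nplus_def by (rule rel_app1[OF rel_app2]) auto

text \<open>The recursion of \<open>nplus\<close> runs over its second argument, so laws about the
  first one need induction.\<close>

lemma rel_zero_nplus:
  assumes "term_of_ty k N"
  shows "rel N (nplus zero k) k"
proof -
  let ?\<phi> = "nplus zero (Bv 0) \<^bold>= Bv 0"
  have "sat Q S (opn 0 k ?\<phi>)"
  proof (rule qf_induct)
    show "sat Q S (opn 0 zero ?\<phi>)" using rel_nplus_zero[of zero] by (simp add: rel_N)
    fix t assume t: "term_of_ty t N" and IH: "sat Q S (opn 0 t ?\<phi>)"
    have "rel N (nplus zero (succ t)) (succ (nplus zero t))" by (rule rel_nplus_succ) (use t in auto)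
    also have "rel N \<dots> (succ t)" by (rule rel_succ_cong) (use IH t in \<open>simp add: rel_N\<close>)
    finally show "sat Q S (opn 0 (succ t) ?\<phi>)" by (simp add: rel_N)
  qed (use assms in auto)
  then show ?thesis using assms by (simp add: rel_N)
qed

lemma rel_succ_nplus:
  assumes s: "term_of_ty s N" and k: "term_of_ty k N"
  shows "rel N (nplus (succ s) k) (succ (nplus s k))"
proof -
  let ?\<phi> = "nplus (succ s) (Bv 0) \<^bold>= succ (nplus s (Bv 0))"
  have s': "term_of_ty (succ s) N" using s by simp
  have "sat Q S (opn 0 k ?\<phi>)"
  proof (rule qf_induct)
    have "rel N (nplus (succ s) zero) (succ (nplus s zero))"
      using rel_trans[OF rel_nplus_zero[OF s'] rel_succ_cong[OF rel_sym[OF rel_nplus_zero[OF s]]]] .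
    then show "sat Q S (opn 0 zero ?\<phi>)" using s by (simp add: rel_N)
    fix t assume t: "term_of_ty t N" and IH: "sat Q S (opn 0 t ?\<phi>)"
    have "rel N (nplus (succ s) (succ t)) (succ (nplus (succ s) t))"
      using rel_nplus_succ[OF s' t] .
    also have "rel N \<dots> (succ (succ (nplus s t)))"
      by (rule rel_succ_cong) (use IH s t in \<open>simp add: rel_N\<close>)
    also have "rel N \<dots> (succ (nplus s (succ t)))"
      using rel_succ_cong[OF rel_sym[OF rel_nplus_succ[OF s t]]] .
    finally show "sat Q S (opn 0 (succ t) ?\<phi>)" using s by (simp add: rel_N)
  qed (use s k has_ty_closed[OF s] in auto)
  then show ?thesis using s k by (simp add: rel_N)
qed

text \<open>Either subtraction was truncated or it is exact. In the induction on \<open>k\<close>,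
  the unit that leaves a nonzero difference is returned by the larger summand.\<close>

lemma monus_nplus:
  assumes j: "term_of_ty j N" and k: "term_of_ty k N"
  shows "rel N (monus j k) zero \<or> rel N (nplus (monus j k) k) j"
proof -
  let ?\<phi> = "monus j (Bv 0) \<^bold>= zero \<^bold>\<or> nplus (monus j (Bv 0)) (Bv 0) \<^bold>= j"
  have "sat Q S (opn 0 k ?\<phi>)"
  proof (rule qf_induct)
    have "rel N (nplus (monus j zero) zero) (monus j zero)" by (rule rel_nplus_zero) (use j in auto)
    also have "rel N \<dots> j" by (rule rel_monus_zero) fact
    finally show "sat Q S (opn 0 zero ?\<phi>)" using j by (simp add: rel_N)
  next
    fix t assume t: "term_of_ty t N" and "sat Q S (opn 0 t ?\<phi>)"
    then have IH: "rel N (monus j t) zero \<or> rel N (nplus (monus j t) t) j"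
      using j by (simp add: rel_N)
    let ?x = "monus j t" and ?y = "monus j (succ t)"
    have x: "term_of_ty ?x N" using j t by simp
    have y: "term_of_ty ?y N" using j t by simp
    have xy: "rel N ?y (pred_fun \<cdot> ?x)" using rel_monus_succ[OF j t] .
    have "rel N ?y zero \<or> rel N (nplus ?y (succ t)) j"
    proof (cases "rel N ?x zero")
      case True
      show ?thesis using rel_trans[OF xy rel_trans[OF rel_pred_cong[OF True] rel_pred_zero]] ..
    next
      case False
      \<comment> \<open>As \<open>?x\<close> is not 0, its predecessor \<open>?y\<close> is proper
        and \<open>succ ?y\<close> gives \<open>?x\<close> back.\<close>
      then have "rel N ?x (succ (pred_fun \<cdot> ?x))" using zero_or_succ[OF x] by blast
      then have xS: "rel N (succ ?y) ?x"
        using rel_trans[OF rel_succ_cong[OF xy] rel_sym] by blast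
      have "rel N (nplus ?y (succ t)) (succ (nplus ?y t))" using rel_nplus_succ[OF y t] .
      also have "rel N \<dots> (nplus (succ ?y) t)" using rel_sym[OF rel_succ_nplus[OF y t]] .
      also have "rel N \<dots> (nplus ?x t)" using rel_nplus_cong[OF xS t] .
      also have "rel N \<dots> j" using IH False by blast
      finally show ?thesis ..
    qed
    then show "sat Q S (opn 0 (succ t) ?\<phi>)" using j by (auto simp: rel_N)
  qed (use j k has_ty_closed[OF j] in auto)
  then show ?thesis using j k by (simp add: rel_N)
qed

end

section \<open>Bounded search\<close>

declare lam.simps [simp del]

text \<open>\<open>search_step\<close> is \<open>\<lambda>a f r i. if f (a i) = 0 then 0 else r\<close>.\<close>

definition search_step :: tm where
  "search_step = lam (0, ty1) (lam (1, ty1) (lam (2, N) (lam (3, N)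
    (rec0 (v 1 ty1 \<cdot> (v 0 ty1 \<cdot> v 3 N)) zero (const2 (v 2 N))))))"

text \<open>The result 1 means that no zero was met; 0, once reached, is kept. Length and
  enumeration come first, so that supplying them leaves a functional of type 2.\<close>

definition search :: tm where
  "search = lam (0, N) (lam (1, ty1) (lam (2, ty1)
    (rec0 (v 0 N) (succ zero) (search_step \<cdot> v 1 ty1 \<cdot> v 2 ty1))))"

text \<open>\<open>cut_off\<close> is \<open>\<lambda>f n. min (f n) 1\<close>.\<close>

definition cut_off :: tm where
  "cut_off = lam (0, ty1) (lam (1, N) (rec0 (v 0 ty1 \<cdot> v 1 N) zero (const2 (succ zero))))"

text \<open>Being closed, this term is standard, so its application to a standard functional is
  standard too.\<close>

definition after_cut_off :: tm where
  "after_cut_off = lam (0, ty2) (lam (1, ty1) (v 0 ty2 \<cdot> (cut_off \<cdot> v 1 ty1)))"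

lemma has_ty_search_step [simp]:
  "\<Delta> \<turnstile> search_step \<triangleright> \<tau> \<longleftrightarrow> \<tau> = ty1 \<rightarrow> ty1 \<rightarrow> N \<rightarrow> N \<rightarrow> N"
  by (rule has_ty_closed_iff, unfold search_step_def, (rule has_ty_lam_pair)+, simp)

lemma fv_search_step [simp]: "fv_tm search_step = {}"
  by (auto simp: search_step_def fv_lam)

lemma has_ty_search [simp]: "\<Delta> \<turnstile> search \<triangleright> \<tau> \<longleftrightarrow> \<tau> = N \<rightarrow> ty1 \<rightarrow> ty1 \<rightarrow> N"
  by (rule has_ty_closed_iff, unfold search_def, (rule has_ty_lam_pair)+, simp)

lemma fv_search [simp]: "fv_tm search = {}"
  by (auto simp: search_def fv_lam)

lemma has_ty_cut_off [simp]: "\<Delta> \<turnstile> cut_off \<triangleright> \<tau> \<longleftrightarrow> \<tau> = ty1 \<rightarrow> ty1"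
  by (rule has_ty_closed_iff, unfold cut_off_def, (rule has_ty_lam_pair)+, simp)

lemma fv_cut_off [simp]: "fv_tm cut_off = {}"
  by (auto simp: cut_off_def fv_lam)

lemma has_ty_after_cut_off [simp]: "\<Delta> \<turnstile> after_cut_off \<triangleright> \<tau> \<longleftrightarrow> \<tau> = ty2 \<rightarrow> ty2"
  by (rule has_ty_closed_iff, unfold after_cut_off_def, (rule has_ty_lam_pair)+, simp)

lemma fv_after_cut_off [simp]: "fv_tm after_cut_off = {}"
  by (auto simp: after_cut_off_def fv_lam)

context epra_model
begin

lemma rel_search_step:
  assumes a: "term_of_ty a ty1" and f: "term_of_ty f ty1" and r: "term_of_ty r N"
    and i: "term_of_ty i N"
  shows "rel N (search_step \<cdot> a \<cdot> f \<cdot> r \<cdot> i) (rec0 (f \<cdot> (a \<cdot> i)) zero (const2 r))"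
proof -
  have "rel N (search_step \<cdot> a \<cdot> f \<cdot> r \<cdot> i)
      (msub (Fv((0, ty1) := a, (1, ty1) := f, (2, N) := r, (3, N) := i))
        (rec0 (v 1 ty1 \<cdot> (v 0 ty1 \<cdot> v 3 N)) zero (const2 (v 2 N))))"
    unfolding search_step_def
    by (rule lam_app[OF lam_app[OF lam_app[OF lam_app[OF rel_msub_Fv]]]])
      (use assms in \<open>auto intro!: has_ty_lam_pair\<close>)
  then show ?thesis by simp
qed

lemma rel_search:
  assumes l: "term_of_ty l N" and a: "term_of_ty a ty1" and f: "term_of_ty f ty1"
  shows "rel N (search \<cdot> l \<cdot> a \<cdot> f) (rec0 l (succ zero) (search_step \<cdot> a \<cdot> f))"
proof -
  have "rel N (search \<cdot> l \<cdot> a \<cdot> f)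
      (msub (Fv((0, N) := l, (1, ty1) := a, (2, ty1) := f))
        (rec0 (v 0 N) (succ zero) (search_step \<cdot> v 1 ty1 \<cdot> v 2 ty1)))"
    unfolding search_def
    by (rule lam_app[OF lam_app[OF lam_app[OF rel_msub_Fv]]])
      (use assms in \<open>auto intro!: has_ty_lam_pair\<close>)
  then show ?thesis by (simp add: msub_closed)
qed

lemma rel_cut_off:
  assumes f: "term_of_ty f ty1" and n: "term_of_ty n N"
  shows "rel N (cut_off \<cdot> f \<cdot> n) (rec0 (f \<cdot> n) zero (const2 (succ zero)))"
proof -
  have "rel N (cut_off \<cdot> f \<cdot> n) (msub (Fv((0, ty1) := f, (1, N) := n))
      (rec0 (v 0 ty1 \<cdot> v 1 N) zero (const2 (succ zero))))"
    unfolding cut_off_def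
    by (rule lam_app[OF lam_app[OF rel_msub_Fv]])
      (use assms in \<open>auto intro!: has_ty_lam_pair\<close>)
  then show ?thesis by simp
qed

lemma rel_after_cut_off:
  assumes z: "term_of_ty z ty2" and f: "term_of_ty f ty1"
  shows "rel N (after_cut_off \<cdot> z \<cdot> f) (z \<cdot> (cut_off \<cdot> f))"
proof -
  have "rel N (after_cut_off \<cdot> z \<cdot> f) (msub (Fv((0, ty2) := z, (1, ty1) := f))
      (v 0 ty2 \<cdot> (cut_off \<cdot> v 1 ty1)))"
    unfolding after_cut_off_def
    by (rule lam_app[OF lam_app[OF rel_msub_Fv]])
      (use assms in \<open>auto intro!: has_ty_lam_pair\<close>)
  then show ?thesis by (simp add: msub_closed)
qed

section \<open>The search through an initial segment of entries\<close>

context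
  fixes a f :: tm
  assumes a: "term_of_ty a ty1" and f: "term_of_ty f ty1"
begin

abbreviation found_below :: "tm \<Rightarrow> tm" where
  "found_below k \<equiv> rec0 k (succ zero) (search_step \<cdot> a \<cdot> f)"

lemmas af_ty = has_ty_closed_iff[OF a] has_ty_closed_iff[OF f]

lemma rel_found_below_zero: "rel N (found_below zero) (succ zero)"
  by (rule rel_rec_zero) (auto simp: af_ty)

lemma rel_found_below_succ:
  assumes k: "term_of_ty k N"
  shows "rel N (found_below (succ k)) (rec0 (f \<cdot> (a \<cdot> k)) zero (const2 (found_below k)))"
  by (rule rel_trans[OF rel_rec_succ rel_search_step]) (use k a f in \<open>auto simp: af_ty\<close>)

lemma rel_found_below_succ_found:
  assumes k: "term_of_ty k N" and "rel N (f \<cdot> (a \<cdot> k)) zero"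
  shows "rel N (found_below (succ k)) zero"
  by (rule rel_trans[OF rel_found_below_succ rel_case_zero]) (use assms in \<open>auto simp: af_ty\<close>)

lemma rel_found_below_succ_not_found:
  assumes k: "term_of_ty k N" and "rel N (f \<cdot> (a \<cdot> k)) (succ m)"
  shows "rel N (found_below (succ k)) (found_below k)"
  by (rule rel_trans[OF rel_found_below_succ rel_case_succ]) (use assms in \<open>auto simp: af_ty\<close>)

lemma found_below_succ_cases:
  assumes k: "term_of_ty k N"
  shows "rel N (found_below (succ k)) zero \<or> rel N (found_below (succ k)) (found_below k)"
proof -
  have "term_of_ty (f \<cdot> (a \<cdot> k)) N" using k by (simp add: af_ty)
  from zero_or_succ[OF this] show ?thesis
    using k rel_found_below_succ_found rel_found_below_succ_not_found by blast
qed

text \<open>Supplies the bound required by \<open>STP2\<close>: the search starts at 1, and each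
  step keeps the value or sets it to 0.\<close>

lemma found_below_le_one:
  assumes k: "term_of_ty k N"
  shows "rel N (found_below k) zero \<or> rel N (found_below k) (succ zero)"
proof -
  let ?p = "rec0 (Bv 0) (succ zero) (search_step \<cdot> a \<cdot> f)"
  let ?\<phi> = "?p \<^bold>= zero \<^bold>\<or> ?p \<^bold>= succ zero"
  have o: "opn 0 t ?\<phi> = (found_below t \<^bold>= zero \<^bold>\<or> found_below t \<^bold>= succ zero)" for t
    using a f by simp
  have s: "sat Q S (opn 0 t ?\<phi>) \<longleftrightarrow>
      rel N (found_below t) zero \<or> rel N (found_below t) (succ zero)"
    if "term_of_ty t N" for t
    using that unfolding o by (simp add: rel_N af_ty)
  have "sat Q S (opn 0 k ?\<phi>)"
  proof (rule qf_induct)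
    show "sat Q S (opn 0 zero ?\<phi>)" using s[of zero] rel_found_below_zero by simp
    fix t assume t: "term_of_ty t N" and "sat Q S (opn 0 t ?\<phi>)"
    then have "rel N (found_below t) zero \<or> rel N (found_below t) (succ zero)" using s by blast
    then have "rel N (found_below (succ t)) zero \<or> rel N (found_below (succ t)) (succ zero)"
      using found_below_succ_cases[OF t] rel_trans by blast
    moreover have "term_of_ty (succ t) N" using t by simp
    ultimately show "sat Q S (opn 0 (succ t) ?\<phi>)" using s by blast
  qed (use k in \<open>auto simp: af_ty\<close>)
  then show ?thesis using s[OF k] by blast
qed

text \<open>The initial value 1 survives every step. Asking for the value 1 at all positions is
  enough, as the function of interest will be constant.\<close>

lemma found_below_none:
  assumes none: "\<And>i. term_of_ty i N \<Longrightarrow> rel N (f \<cdot> (a \<cdot> i)) (succ zero)"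
    and k: "term_of_ty k N"
  shows "rel N (found_below k) (succ zero)"
proof -
  let ?\<phi> = "rec0 (Bv 0) (succ zero) (search_step \<cdot> a \<cdot> f) \<^bold>= succ zero"
  have s: "sat Q S (opn 0 t ?\<phi>) \<longleftrightarrow> rel N (found_below t) (succ zero)"
    if "term_of_ty t N" for t
    using that a f by (simp add: rel_N af_ty)
  have "sat Q S (opn 0 k ?\<phi>)"
  proof (rule qf_induct)
    show "sat Q S (opn 0 zero ?\<phi>)" using s[of zero] rel_found_below_zero by simp
    fix t assume t: "term_of_ty t N" and "sat Q S (opn 0 t ?\<phi>)"
    then have "rel N (found_below t) (succ zero)" using s by blast
    then have "rel N (found_below (succ t)) (succ zero)"
      using rel_found_below_succ_not_found[OF t none[OF t]] rel_trans by blast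
    moreover have "term_of_ty (succ t) N" using t by simp
    ultimately show "sat Q S (opn 0 (succ t) ?\<phi>)" using s by blast
  qed (use k in \<open>auto simp: af_ty\<close>)
  then show ?thesis using s[OF k] by blast
qed

text \<open>Induction on \<open>k\<close>: either \<open>j\<close> was already passed at
  \<open>t\<close> and the result 0 is kept, or the step at \<open>t\<close> inspects position
  \<open>j\<close> itself.\<close>

lemma found_below_found:
  assumes j: "term_of_ty j N" and fj: "rel N (f \<cdot> (a \<cdot> j)) zero" and k: "term_of_ty k N"
    and jk: "rel N (monus (succ j) k) zero"
  shows "rel N (found_below k) zero"
proof -
  let ?\<phi> = "monus (succ j) (Bv 0) \<^bold>= zero \<^bold>\<longrightarrow>
    rec0 (Bv 0) (succ zero) (search_step \<cdot> a \<cdot> f) \<^bold>= zero"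
  have sj: "term_of_ty (succ j) N" using j by simp
  have s: "sat Q S (opn 0 t ?\<phi>) \<longleftrightarrow>
      (rel N (monus (succ j) t) zero \<longrightarrow> rel N (found_below t) zero)"
    if "term_of_ty t N" for t
    using that j a f by (simp add: rel_N af_ty)
  have "sat Q S (opn 0 k ?\<phi>)"
  proof (rule qf_induct)
    have "\<not> rel N (monus (succ j) zero) zero"
      using rel_monus_zero[OF sj] not_rel_succ_zero rel_sym rel_trans by blast
    then show "sat Q S (opn 0 zero ?\<phi>)" using s[of zero] by simp
  next
    fix t assume t: "term_of_ty t N" and "sat Q S (opn 0 t ?\<phi>)"
    then have IH: "rel N (monus (succ j) t) zero \<longrightarrow> rel N (found_below t) zero" using s by blast
    let ?x = "monus (succ j) t"
    have x: "term_of_ty ?x N" using t sj by simp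
    have "rel N (found_below (succ t)) zero" if "rel N (monus (succ j) (succ t)) zero"
    proof (cases "rel N ?x zero")
      case True
      then show ?thesis using IH found_below_succ_cases[OF t] rel_trans by blast
    next
      case False
      then have "rel N ?x (succ (pred_fun \<cdot> ?x))" using zero_or_succ[OF x] by blast
      moreover have "rel N (pred_fun \<cdot> ?x) zero"
        using rel_trans[OF rel_sym[OF rel_monus_succ[OF sj t]] that] .
      \<comment> \<open>The difference of \<open>succ j\<close> and \<open>t\<close> is nonzero with
        predecessor 0, hence 1. Adding \<open>t\<close> back gives 1 + \<open>t\<close> =
        \<open>succ j\<close>, which identifies \<open>t\<close> with \<open>j\<close>.\<close>
      ultimately have x1: "rel N ?x (succ zero)" using rel_succ_cong rel_trans by blast
      have z: "term_of_ty zero N" by simp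
      have "rel N (succ t) (succ (nplus zero t))"
        using rel_succ_cong[OF rel_sym[OF rel_zero_nplus[OF t]]] .
      also have "rel N \<dots> (nplus (succ zero) t)" using rel_sym[OF rel_succ_nplus[OF z t]] .
      also have "rel N \<dots> (nplus ?x t)" using rel_nplus_cong[OF rel_sym[OF x1] t] .
      also have "rel N \<dots> (succ j)" using monus_nplus[OF sj t] False by blast
      finally have tj: "rel N t j" by (rule rel_succ_inj)
      have "rel N (f \<cdot> (a \<cdot> t)) (f \<cdot> (a \<cdot> j))" using rel_app2[OF f rel_app2[OF a tj]] .
      then show ?thesis using rel_found_below_succ_found[OF t] fj rel_trans by blast
    qed
    moreover have "term_of_ty (succ t) N" using t by simp
    ultimately show "sat Q S (opn 0 (succ t) ?\<phi>)" using s by blast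
  qed (use j k has_ty_closed[OF j] in \<open>auto simp: af_ty\<close>)
  then show ?thesis using s[OF k] jk by blast
qed

end

end

section \<open>Standardness\<close>

lemma cls_mem [simp]: "cls k x (mem \<sigma> s t) = mem \<sigma> (cls_tm k x s) (cls_tm k x t)"
  by (simp add: mem_def lt_def le_def)

lemma opn_mem [simp]:
  "term_of_ty u \<rho> \<Longrightarrow> opn k u (mem \<sigma> s t) = mem \<sigma> (opn_tm k u s) (opn_tm k u t)"
  by (simp add: mem_def lt_def le_def)

locale stp_model =
  fixes Q :: "tm \<Rightarrow> tm \<Rightarrow> bool" and S :: "tm \<Rightarrow> bool"
  assumes sound: "P0 \<union> {relat E2, STP2} \<tturnstile> \<phi> \<Longrightarrow> formula \<phi> \<Longrightarrow> sat Q S \<phi>"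

sublocale stp_model \<subseteq> epra_model "P0 \<union> {relat E2, STP2}" Q S
proof unfold_locales
  show "EPRA \<subseteq> P0 \<union> {relat E2, STP2}" by (auto simp: P0_def)
qed (rule sound)

context stp_model
begin

lemma st_closed_term:
  assumes "term_of_ty t \<sigma>" "fv_tm t = {}"
  shows "S t"
proof -
  have "St t \<in> P0" using ST_ax.st_closed[OF assms] by (simp add: P0_def)
  then have "sat Q S (foldr all_v [] (St t))" by (intro sat_closure) (use assms in auto)
  then show ?thesis by simp
qed

lemma st_application:
  assumes "term_of_ty f (\<sigma> \<rightarrow> \<tau>)" "term_of_ty a \<sigma>" "S f" "S a"
  shows "S (f \<cdot> a)"
proof -
  let ?A = "St (v 0 (\<sigma> \<rightarrow> \<tau>)) \<^bold>\<and> St (v 1 \<sigma>) \<^bold>\<longrightarrow> St (v 0 (\<sigma> \<rightarrow> \<tau>) \<cdot> v 1 \<sigma>)"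
  have "?A \<in> P0" using ST_ax.st_app[of \<sigma> \<tau>] by (simp add: P0_def)
  then have "sat Q S (foldr all_v [(0, \<sigma> \<rightarrow> \<tau>), (1, \<sigma>)] ?A)" by (intro sat_closure) auto
  moreover have "sat Q S (foldr all_v [(0, \<sigma> \<rightarrow> \<tau>), (1, \<sigma>)] ?A) \<longleftrightarrow>
    (\<forall>f. term_of_ty f (\<sigma> \<rightarrow> \<tau>) \<longrightarrow> (\<forall>a. term_of_ty a \<sigma> \<longrightarrow> S f \<and> S a \<longrightarrow> S (f \<cdot> a)))"
    by (simp add: all_v_def)
  ultimately show ?thesis using assms by blast
qed

abbreviation entry :: "tm \<Rightarrow> tm \<Rightarrow> bool" where
  "entry n s \<equiv> \<exists>j. term_of_ty j N \<and> Q (monus (succ j) (Cn (LenC N) \<cdot> s)) zero \<and>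
    Q n (Cn (AtC N) \<cdot> s \<cdot> j)"

lemma sat_mem:
  assumes "term_of_ty n N" "term_of_ty s (Seq N)"
  shows "sat Q S (mem N n s) \<longleftrightarrow> entry n s"
  using assms by (simp add: mem_def lt_def le_def)

text \<open>Idealisation is applied to \<open>x \<in> y\<close>: its premise then holds with the given sequence as
  witness.\<close>

lemma all_standard_numbers_in_sequence:
  obtains s where "term_of_ty s (Seq N)"
    "\<And>n. term_of_ty n N \<Longrightarrow> S n \<Longrightarrow>
entry n s"
proof -
  let ?\<phi> = "mem N (v 0 N) (v 1 (Seq N))"
  let ?I = "(\<^bold>\<forall>\<^sup>s\<^sup>t(2, Seq N). \<^bold>\<exists>(1, Seq N). \<^bold>\<forall>(0, N). (mem N (v 0 N) (v 2 (Seq N)) \<^bold>\<longrightarrow> ?\<phi>)) \<^bold>\<longrightarrow>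
    (\<^bold>\<exists>(1, Seq N). \<^bold>\<forall>\<^sup>s\<^sup>t(0, N). ?\<phi>)"
  have \<phi>: "formula ?\<phi>" "internal ?\<phi>" "formula (mem N (v 0 N) (v 2 (Seq N)))"
    by (simp_all add: mem_def lt_def le_def)
  have "(2, Seq N) \<notin> fv ?\<phi>"
    by (simp add: mem_def lt_def le_def monus_def pred_fun_def id_fun_def)
  then have "(\<^bold>\<forall>\<^sup>s\<^sup>t(2, Seq N). \<^bold>\<exists>(1, Seq N). \<^bold>\<forall>(0, N). (mem N (v 0 N) (v 2 (Seq N)) \<^bold>\<longrightarrow> ?\<phi>)) \<^bold>\<longrightarrow>
    (\<^bold>\<exists>(1, Seq N). \<^bold>\<forall>\<^sup>s\<^sup>t(0, N). ?\<phi>) \<in> Idealisation"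
    by (intro Idealisation.intros[OF \<phi>(1,2) refl refl _ refl]) auto
  moreover have "formula ?I" using \<phi> by simp
  ultimately have I: "sat Q S ?I" using sat_closure[of ?I "[]"] by (simp add: P0_def)
  have "sat Q S ?I \<longleftrightarrow>
    ((\<forall>w. term_of_ty w (Seq N) \<longrightarrow> S w \<longrightarrow>
      (\<exists>s. term_of_ty s (Seq N) \<and>
        (\<forall>n. term_of_ty n N \<longrightarrow> sat Q S (mem N n w) \<longrightarrow> sat Q S (mem N n s)))) \<longrightarrow>
     (\<exists>s. term_of_ty s (Seq N) \<and> (\<forall>n. term_of_ty n N \<longrightarrow> S n \<longrightarrow> sat Q S (mem N n s))))"
    by (simp add: all_v_def ex_v_def cong: conj_cong)
  with I have "\<exists>s. term_of_ty s (Seq N) \<and> (\<forall>n. term_of_ty n N \<longrightarrow> S n \<longrightarrow> sat Q S (mem N n s))"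
    by blast
  then show thesis using that sat_mem by blast
qed

lemma sat_STP2:
  assumes Y: "term_of_ty Y ty2"
    and le: "\<And>f. term_of_ty f ty1 \<Longrightarrow> rel N (monus (Y \<cdot> f) (succ zero)) zero"
  obtains Z where "term_of_ty Z ty2" "S Z"
    "\<And>f. term_of_ty f ty1 \<Longrightarrow> S f \<Longrightarrow> rel N (Z \<cdot> f) (Y \<cdot> f)"
proof -
  have "formula STP2"
    by (simp add: STP2_def le2_one_def approx2_def le_def Let_def)
  then have "sat Q S STP2" using sat_closure[of STP2 "[]"] by simp
  moreover have "sat Q S STP2 \<longleftrightarrow> (\<forall>Y. term_of_ty Y ty2 \<longrightarrow>
    (\<forall>f. term_of_ty f ty1 \<longrightarrow> Q (monus (Y \<cdot> f) (succ zero)) zero) \<longrightarrow>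
    (\<exists>Z. term_of_ty Z ty2 \<and> S Z \<and>
      (\<forall>f. term_of_ty f ty1 \<longrightarrow> Q (monus (Z \<cdot> f) (succ zero)) zero) \<and>
      (\<forall>f. term_of_ty f ty1 \<longrightarrow> S f \<longrightarrow> Q (Z \<cdot> f) (Y \<cdot> f))))"
    by (simp add: STP2_def le2_one_def approx2_def le_def Let_def all_v_def ex_v_def
        cong: conj_cong)
  ultimately have "\<exists>Z. term_of_ty Z ty2 \<and> S Z \<and>
      (\<forall>f. term_of_ty f ty1 \<longrightarrow> S f \<longrightarrow> Q (Z \<cdot> f) (Y \<cdot> f))"
    using Y le unfolding rel_N by blast
  then obtain Z where Z: "term_of_ty Z ty2" "S Z"
    "\<And>f. term_of_ty f ty1 \<Longrightarrow> S f \<Longrightarrow> Q (Z \<cdot> f) (Y \<cdot> f)" by blast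
  show thesis
  proof (rule that[OF Z(1,2)])
    show "rel N (Z \<cdot> f) (Y \<cdot> f)" if "term_of_ty f ty1" "S f" for f
      using Y Z that by (auto simp: rel_N)
  qed
qed

text \<open>Relativisation also reaches the quantifier hidden in \<open>eq ty1\<close>: agreement at
  standard numbers suffices, provided that both functions and the functional are standard.\<close>

lemma sat_E2:
  assumes x: "term_of_ty x ty1" "S x" and y: "term_of_ty y ty1" "S y"
    and Z: "term_of_ty Z ty2" "S Z"
    and xy: "\<And>n. term_of_ty n N \<Longrightarrow> S n \<Longrightarrow> rel N (x \<cdot> n) (y \<cdot> n)"
  shows "rel N (Z \<cdot> x) (Z \<cdot> y)"
proof -
  have "formula (relat E2)" by (simp add: E2_def Let_def all_v_def)
  then have "sat Q S (relat E2)" using sat_closure[of "relat E2" "[]"] by simp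
  moreover have "sat Q S (relat E2) \<longleftrightarrow> (\<forall>x. term_of_ty x ty1 \<longrightarrow> S x \<longrightarrow>
    (\<forall>y. term_of_ty y ty1 \<longrightarrow> S y \<longrightarrow> (\<forall>Z. term_of_ty Z ty2 \<longrightarrow> S Z \<longrightarrow>
      (\<forall>n. term_of_ty n N \<longrightarrow> S n \<longrightarrow> Q (x \<cdot> n) (y \<cdot> n)) \<longrightarrow> Q (Z \<cdot> x) (Z \<cdot> y))))"
    by (simp add: E2_def Let_def all_v_def)
  ultimately have "Q (Z \<cdot> x) (Z \<cdot> y)" using x y Z xy unfolding rel_N by blast
  then show ?thesis using x y Z by (auto simp: rel_N)
qed

section \<open>The standard functional that decides standard zeros\<close>

lemma sat_Exists2: "sat Q S (relat Exists2)"
proof -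
  obtain s where s: "term_of_ty s (Seq N)" and in_s: "\<And>n. term_of_ty n N \<Longrightarrow> S n \<Longrightarrow> entry n s"
    using all_standard_numbers_in_sequence by blast
  \<comment> \<open>The sequence enters the search only as a length and a function on
    positions.\<close>
  define l a where "l = Cn (LenC N) \<cdot> s" and "a = Cn (AtC N) \<cdot> s"
  have l: "term_of_ty l N" and a: "term_of_ty a ty1" using s by (simp_all add: l_def a_def)
  define Y where "Y = search \<cdot> l \<cdot> a"
  have Y: "term_of_ty Y ty2" using l a by (simp add: Y_def)
  note rel_Y = rel_search[OF l a, folded Y_def]
  have Y_le: "rel N (monus (Y \<cdot> f) (succ zero)) zero" if f: "term_of_ty f ty1" for f
  proof -
    let ?y = "Y \<cdot> f"
    have y: "term_of_ty ?y N" using Y f by (rule ty_App)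
    have z: "term_of_ty zero N" by simp
    \<comment> \<open>The bound by 1 unfolds to the vanishing of \<open>?y\<close> minus 1, and
      subtracting 1 is taking the predecessor.\<close>
    have "rel N (monus ?y (succ zero)) (pred_fun \<cdot> ?y)"
      using rel_trans[OF rel_monus_succ[OF y z] rel_pred_cong[OF rel_monus_zero[OF y]]] .
    moreover have "rel N ?y zero \<or> rel N ?y (succ zero)"
      using found_below_le_one[OF a f l] rel_Y[OF f] rel_trans by blast
    then have "rel N (pred_fun \<cdot> ?y) zero"
      using rel_trans[OF rel_pred_cong rel_pred_zero] rel_trans[OF rel_pred_cong rel_pred_succ[OF z]]
      by blast
    ultimately show ?thesis by (rule rel_trans)
  qed
  obtain Z where Z: "term_of_ty Z ty2" "S Z"
    and ZY: "\<And>f. term_of_ty f ty1 \<Longrightarrow> S f \<Longrightarrow> rel N (Z \<cdot> f) (Y \<cdot> f)"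
    using sat_STP2[OF Y Y_le] by blast
  define \<phi> where "\<phi> = after_cut_off \<cdot> Z"
  have \<phi>: "term_of_ty \<phi> ty2" using Z by (simp add: \<phi>_def)
  have "S after_cut_off" by (rule st_closed_term[of _ "ty2 \<rightarrow> ty2"]) auto
  then have S_\<phi>: "S \<phi>"
    unfolding \<phi>_def by (intro st_application[of _ ty2 ty2]) (use Z in auto)
  have rel_\<phi>: "rel N (\<phi> \<cdot> f) (Y \<cdot> (cut_off \<cdot> f))" and S_cut: "S (cut_off \<cdot> f)"
    if f: "term_of_ty f ty1" "S f" for f
  proof -
    have c: "term_of_ty (cut_off \<cdot> f) ty1" using f by simp
    have "S cut_off" by (rule st_closed_term[of _ "ty1 \<rightarrow> ty1"]) auto
    then show "S (cut_off \<cdot> f)" by (intro st_application[of _ ty1 ty1]) (use f in auto)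
    with ZY[OF c] rel_after_cut_off[OF Z(1) f(1)] show "rel N (\<phi> \<cdot> f) (Y \<cdot> (cut_off \<cdot> f))"
      unfolding \<phi>_def by (blast intro: rel_trans)
  qed
  have "rel N (\<phi> \<cdot> f) zero"
    if f: "term_of_ty f ty1" "S f" and n: "term_of_ty n N" "S n" "rel N (f \<cdot> n) zero" for f n
  proof -
    let ?g = "cut_off \<cdot> f"
    have g: "term_of_ty ?g ty1" using f by simp
    \<comment> \<open>The standard zero \<open>n\<close> occurs in the sequence up to equality only;
      extensionality of \<open>?g\<close> carries its value to the entry at
      \<open>j\<close>.\<close>
    obtain j where j: "term_of_ty j N" "rel N (monus (succ j) l) zero" "rel N n (a \<cdot> j)"
      using in_s[OF n(1,2)] n(1) s unfolding l_def a_def rel_N by auto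
    have "rel N (?g \<cdot> (a \<cdot> j)) (?g \<cdot> n)" by (rule rel_app2[OF g rel_sym[OF j(3)]])
    also have "rel N \<dots> zero"
      by (rule rel_trans[OF rel_cut_off[OF f(1) n(1)] rel_case_zero[OF n(3)]]) auto
    finally have "rel N (rec0 l (succ zero) (search_step \<cdot> a \<cdot> ?g)) zero"
      using found_below_found[OF a g j(1) _ l j(2)] by blast
    then show ?thesis using rel_\<phi>[OF f] rel_Y[OF g] rel_trans by blast
  qed
  moreover have "\<exists>n. term_of_ty n N \<and> S n \<and> rel N (f \<cdot> n) zero"
    if f: "term_of_ty f ty1" "S f" and zero: "rel N (\<phi> \<cdot> f) zero" for f
  proof (rule ccontr)
    assume none: "\<nexists>n. term_of_ty n N \<and> S n \<and> rel N (f \<cdot> n) zero"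
    \<comment> \<open>The constant function 1 is a closed term, hence standard, as standard
      extensionality demands.\<close>
    let ?g = "cut_off \<cdot> f" and ?one = "Cn (PiC N N) \<cdot> succ zero"
    have g: "term_of_ty ?g ty1" using f by simp
    have one: "term_of_ty ?one ty1" "S ?one" by (auto intro!: st_closed_term)
    have at_one: "rel N (?one \<cdot> n) (succ zero)" if "term_of_ty n N" for n
      by (rule rel_Pi) (use that in auto)
    have "rel N (?g \<cdot> n) (?one \<cdot> n)" if n: "term_of_ty n N" "S n" for n
    proof -
      have fn: "term_of_ty (f \<cdot> n) N" using f(1) n(1) by (rule ty_App)
      \<comment> \<open>A nonzero value is a successor, which truncation turns into 1.\<close>
      then have "rel N (f \<cdot> n) (succ (pred_fun \<cdot> (f \<cdot> n)))" using zero_or_succ none n by blast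
      then have "rel N (rec0 (f \<cdot> n) zero (const2 (succ zero))) (succ zero)"
        by (rule rel_case_succ) auto
      then show ?thesis
        using rel_cut_off[OF f(1) n(1)] rel_sym[OF at_one[OF n(1)]] rel_trans by blast
    qed
    then have Zg: "rel N (Z \<cdot> ?g) (Z \<cdot> ?one)" by (rule sat_E2[OF g S_cut[OF f] one Z])
    \<comment> \<open>This holds at all entries, standard or not, whereas \<open>?g\<close> is known
      to be 1 at standard numbers only. The detour through \<open>Z\<close> carries the value of
      \<open>Y\<close> from \<open>?one\<close> to \<open>?g\<close>.\<close>
    have "rel N (?one \<cdot> (a \<cdot> i)) (succ zero)" if "term_of_ty i N" for i
      by (rule at_one) (rule ty_App[OF a that])
    then have Yone: "rel N (Y \<cdot> ?one) (succ zero)"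
      using rel_trans[OF rel_Y[OF one(1)] found_below_none[OF a one(1) _ l]] by blast
    have "rel N (succ zero) (Y \<cdot> ?one)" by (rule rel_sym[OF Yone])
    also have "rel N \<dots> (Z \<cdot> ?one)" by (rule rel_sym[OF ZY[OF one]])
    also have "rel N \<dots> (Z \<cdot> ?g)" by (rule rel_sym[OF Zg])
    also have "rel N \<dots> (Y \<cdot> ?g)" by (rule ZY[OF g S_cut[OF f]])
    also have "rel N \<dots> (\<phi> \<cdot> f)" by (rule rel_sym[OF rel_\<phi>[OF f]])
    also note zero
    finally show False using not_rel_succ_zero by blast
  qed
  ultimately have "\<exists>\<phi>. term_of_ty \<phi> ty2 \<and> S \<phi> \<and> (\<forall>f. term_of_ty f ty1 \<longrightarrow> S f \<longrightarrow>
      ((\<exists>n. term_of_ty n N \<and> S n \<and> rel N (f \<cdot> n) zero) \<longleftrightarrow> rel N (\<phi> \<cdot> f) zero))"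
    using \<phi> S_\<phi> by blast
  moreover have "sat Q S (relat Exists2) \<longleftrightarrow>
    (\<exists>\<phi>. term_of_ty \<phi> ty2 \<and> S \<phi> \<and> (\<forall>f. term_of_ty f ty1 \<longrightarrow> S f \<longrightarrow>
      ((\<exists>n. term_of_ty n N \<and> S n \<and> Q (f \<cdot> n) zero) \<longrightarrow> Q (\<phi> \<cdot> f) zero) \<and>
      (Q (\<phi> \<cdot> f) zero \<longrightarrow> (\<exists>n. term_of_ty n N \<and> S n \<and> Q (f \<cdot> n) zero))))"
    by (simp add: Exists2_def Let_def all_v_def ex_v_def cong: conj_cong)
  moreover have "rel N (f \<cdot> n) zero \<longleftrightarrow> Q (f \<cdot> n) zero"
    if "term_of_ty f (\<sigma> \<rightarrow> N)" "term_of_ty n \<sigma>" for f n \<sigma>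
    using ty_App[OF that] by (simp only: rel_N has_ty_Cn cn_ty.simps simp_thms)
  ultimately show ?thesis by (smt (verit))
qed

end

theorem theorem3p19:
  shows "P0 \<union> {relat E2, STP2} \<tturnstile> relat Exists2"
proof (rule completeness)
  show "formula (relat Exists2)" by (simp add: Exists2_def Let_def all_v_def ex_v_def)
  fix Q S
  assume "\<And>\<phi>. P0 \<union> {relat E2, STP2} \<tturnstile> \<phi> \<Longrightarrow> formula \<phi> \<Longrightarrow> sat Q S \<phi>"
  then interpret stp_model Q S by unfold_locales
  show "sat Q S (relat Exists2)" by (rule sat_Exists2)
qed

end
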